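(* Let $b\ge3$, $D\subset\{0,\dots,b-1\}$ with $2\le|D|<b$, let $s=\gcd\{d-d':d,d'\in D\}$, and assume $s\mid d$ for all $d\in D$. List $\mathcal C_{b,D}$ increasingly as $k_1<k_2<\cdots$. Let $U,V$ be commuting unitary operators on a Hilbert space $\mathcal H$. Then for every $x\in\mathcal H$ the limit $\lim_{N\to\infty}\frac1N\sum_{n=1}^N U^{k_n}V^{s_b(k_n)}x$ exists in norm. Moreover, the limit for $x$ equals the limit for $Px$, where $P$ is the orthogonal projection onto the closed span of the joint eigenvectors $y$ with $Uy=e(\alpha)y$, $Vy=e(\beta)y$ for which there exist integers $a,r,t$ with $s\alpha\equiv\frac{a}{b-1}+\frac{r}{b^t}$ and $s\beta\equiv-\frac{a}{b-1}\pmod 1$; in particular the limit is $0$ if $x$ is orthogonal to all such eigenvectors.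
   Context: $\mathcal C_{b,D}=\{\sum_{j=0}^{k} d_j b^j : k\in\mathbb N_0,\ d_j\in D\}$; $s_b$ is the base-$b$ sum of digits; $e(x)=e^{2\pi ix}$. *)

theory Defs
  imports "HOL-Analysis.Analysis" "HOL-Library.Infinite_Set"
begin

definition hnorm :: "('h \<Rightarrow> 'h \<Rightarrow> complex) \<Rightarrow> 'h \<Rightarrow> real" where
  "hnorm ip x = sqrt (Re (ip x x))"

definition complex_hilbert ::
  "(complex \<Rightarrow> 'h::ab_group_add \<Rightarrow> 'h) \<Rightarrow> ('h \<Rightarrow> 'h \<Rightarrow> complex) \<Rightarrow> bool" where
  "complex_hilbert sc ip \<longleftrightarrow>
     Vector_Spaces.vector_space sc \<and>
     (\<forall>x y z. ip (x + y) z = ip x z + ip y z) \<and>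
     (\<forall>a x y. ip (sc a x) y = a * ip x y) \<and>
     (\<forall>x y. ip y x = cnj (ip x y)) \<and>
     (\<forall>x. 0 \<le> Re (ip x x)) \<and>
     (\<forall>x. ip x x = 0 \<longrightarrow> x = 0) \<and>
     (\<forall>X. (\<forall>e>0. \<exists>M. \<forall>m\<ge>M. \<forall>n\<ge>M. hnorm ip (X m - X n) < e)
          \<longrightarrow> (\<exists>L. (\<lambda>n. hnorm ip (X n - L)) \<longlonglongrightarrow> 0))"

definition unitary_op ::
  "(complex \<Rightarrow> 'h::ab_group_add \<Rightarrow> 'h) \<Rightarrow> ('h \<Rightarrow> 'h \<Rightarrow> complex) \<Rightarrow> ('h \<Rightarrow> 'h) \<Rightarrow> bool" where
  "unitary_op sc ip U \<longleftrightarrow> Vector_Spaces.linear sc sc U \<and> bij U \<and>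
     (\<forall>x y. ip (U x) (U y) = ip x y)"

definition hconv :: "('h::ab_group_add \<Rightarrow> 'h \<Rightarrow> complex) \<Rightarrow> (nat \<Rightarrow> 'h) \<Rightarrow> 'h \<Rightarrow> bool" where
  "hconv ip X L \<longleftrightarrow> (\<lambda>n. hnorm ip (X n - L)) \<longlonglongrightarrow> 0"

definition closed_span ::
  "(complex \<Rightarrow> 'h::ab_group_add \<Rightarrow> 'h) \<Rightarrow> ('h \<Rightarrow> 'h \<Rightarrow> complex) \<Rightarrow> 'h set \<Rightarrow> 'h set" where
  "closed_span sc ip E = {p. \<forall>e>0. \<exists>w\<in>module.span sc E. hnorm ip (p - w) < e}"

definition is_orth_proj ::
  "(complex \<Rightarrow> 'h::ab_group_add \<Rightarrow> 'h) \<Rightarrow> ('h \<Rightarrow> 'h \<Rightarrow> complex) \<Rightarrow> 'h set \<Rightarrow> 'h \<Rightarrow> 'h \<Rightarrow> bool" where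
  "is_orth_proj sc ip E x p \<longleftrightarrow> p \<in> closed_span sc ip E \<and> (\<forall>y\<in>E. ip (x - p) y = 0)"

function digsum :: "nat \<Rightarrow> nat \<Rightarrow> nat" where
  "digsum b n = (if b \<le> 1 \<or> n = 0 then 0 else n mod b + digsum b (n div b))"
  by auto
termination
  by (relation "Wellfounded.measure snd") auto

definition digit_set :: "nat \<Rightarrow> nat set \<Rightarrow> nat set" where
  "digit_set b D = {(\<Sum>j\<le>k. d j * b ^ j) | k d. \<forall>j\<le>k. d j \<in> D}"

definition e :: "real \<Rightarrow> complex" where
  "e x = cis (2 * pi * x)"

end

theory Submission
  imports Defs
begin

text \<open>
  Write \<open>Z\<^sub>j = U\<^bsup>b^j\<^esup> V\<close>, let \<open>T\<^sub>j\<close> be the average of the powers \<open>Z\<^sub>j\<^bsup>d\<^esup>\<close> over \<open>d \<in> D\<close>, and put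
  \<open>B\<^sub>m = T\<^sub>0 \<cdots> T\<^bsub>m-1\<^esub>\<close>. Cutting an initial segment of the digit set into blocks with common
  leading digits, the average of length \<open>N\<close> at \<open>x\<close> is, up to \<open>O(b\<^sup>m / N)\<close>, a subconvex
  combination of isometric images of \<open>B\<^sub>m x\<close>. For an eigenvector in the theorem
  these images all agree once \<open>m\<close> is large, so the averages converge; it remains to show
  \<open>B\<^sub>m x \<longlonglongrightarrow> 0\<close> for \<open>x\<close> orthogonal to these eigenvectors.

  Let \<open>W\<^sub>j = Z\<^sub>j\<^sup>s\<close> and \<open>V' = V\<^bsup>s(b-1)\<^esup>\<close>, so \<open>W\<^sub>j\<^sup>b = W\<^bsub>j+1\<^esub> V'\<close>. The variance identity gives
  \<open>\<parallel>W\<^sub>j y - y\<parallel>\<^sup>2 \<le> K (\<parallel>y\<parallel>\<^sup>2 - \<parallel>T\<^sub>j y\<parallel>\<^sup>2)\<close>, hence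
  \<open>\<Sum>\<^bsub>m\<le>j<n\<^esub> \<parallel>W\<^sub>j B\<^sub>n x - B\<^sub>n x\<parallel>\<^sup>2 \<le> K (\<parallel>B\<^sub>m x\<parallel>\<^sup>2 - \<parallel>B\<^sub>n x\<parallel>\<^sup>2)\<close>. Consequently \<open>V' B\<^sub>n x - B\<^sub>n x\<close> tends
  to \<open>0\<close>, and by the mean ergodic theorem one may assume \<open>V' x = x\<close>. Then the powers
  \<open>W\<^sub>m\<^bsup>b^j\<^esup>\<close> act as \<open>W\<^bsub>m+j\<^esub>\<close>, and the same variance identity bounds
  \<open>\<parallel>B\<^sub>n x\<parallel>\<^sup>2\<close> by the squared norm of the ergodic average of \<open>W\<^sub>m\<close> of length \<open>b\<^bsup>n-m\<^esup>\<close> plus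
  \<open>b\<^sup>2 K (\<parallel>B\<^sub>m x\<parallel>\<^sup>2 - \<parallel>B\<^sub>n x\<parallel>\<^sup>2)\<close>. The first term vanishes as \<open>n \<rightarrow> \<infinity>\<close>, because the common
  fixed vectors of \<open>W\<^sub>m\<close> and \<open>V'\<close> are spanned by the eigenvectors, and then the second as
  \<open>m \<rightarrow> \<infinity>\<close>.
\<close>

subsection \<open>Complex Hilbert spaces\<close>

locale hilbert =
  fixes sc :: "complex \<Rightarrow> 'h::ab_group_add \<Rightarrow> 'h" and ip :: "'h \<Rightarrow> 'h \<Rightarrow> complex"
  assumes hilbert: "complex_hilbert sc ip"
begin

sublocale vs: vector_space sc
  using hilbert by (simp add: complex_hilbert_def)

abbreviation nrm :: "'h \<Rightarrow> real" where "nrm \<equiv> hnorm ip"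

lemmas hilbert_props = hilbert[unfolded complex_hilbert_def, THEN conjunct2]

lemma ip_add_left: "ip (x + y) z = ip x z + ip y z"
  using conjunct1[OF hilbert_props] by simp

lemma ip_scale_left: "ip (sc a x) y = a * ip x y"
  using conjunct1[OF conjunct2[OF hilbert_props]] by simp

lemma ip_commute: "ip y x = cnj (ip x y)"
  using conjunct1[OF conjunct2[OF conjunct2[OF hilbert_props]]] by (elim allE)

lemma ip_ge_0: "0 \<le> Re (ip x x)"
  using conjunct1[OF conjunct2[OF conjunct2[OF conjunct2[OF hilbert_props]]]] by simp

lemma ip_definite: "ip x x = 0 \<Longrightarrow> x = 0"
  using conjunct1[OF conjunct2[OF conjunct2[OF conjunct2[OF conjunct2[OF hilbert_props]]]]] by simp

lemma complete:
  assumes "\<And>r. r > 0 \<Longrightarrow> \<exists>M. \<forall>m\<ge>M. \<forall>n\<ge>M. nrm (X m - X n) < r"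
  shows "\<exists>L. hconv ip X L"
  using conjunct2[OF conjunct2[OF conjunct2[OF conjunct2[OF conjunct2[OF hilbert_props]]]]] assms
  unfolding hconv_def by blast

lemma ip_add_right: "ip z (x + y) = ip z x + ip z y"
  using ip_add_left[of x y z] ip_commute[of z] by (metis complex_cnj_add)

lemma ip_scale_right: "ip x (sc a y) = cnj a * ip x y"
  using ip_scale_left[of a y x] ip_commute[of x] by (metis complex_cnj_mult)

lemma ip_zero_left [simp]: "ip 0 y = 0"
  using ip_add_left[of 0 0 y] by simp

lemma ip_zero_right [simp]: "ip y 0 = 0"
  using ip_add_right[of y 0 0] by simp

lemma ip_minus_left: "ip (- x) y = - ip x y"
  using ip_add_left[of x "- x" y] by (simp add: eq_neg_iff_add_eq_0 add.commute)

lemma ip_minus_right: "ip y (- x) = - ip y x"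
  using ip_add_right[of y x "- x"] by (simp add: eq_neg_iff_add_eq_0 add.commute)

lemma ip_diff_left: "ip (x - y) z = ip x z - ip y z"
  using ip_add_left[of x "- y" z] by (simp add: ip_minus_left)

lemma ip_diff_right: "ip z (x - y) = ip z x - ip z y"
  using ip_add_right[of z x "- y"] by (simp add: ip_minus_right)

lemma ip_sum_left: "ip (sum f S) y = (\<Sum>i\<in>S. ip (f i) y)"
  by (induction S rule: infinite_finite_induct) (auto simp: ip_add_left)

lemma ip_sum_right: "ip y (sum f S) = (\<Sum>i\<in>S. ip y (f i))"
  by (induction S rule: infinite_finite_induct) (auto simp: ip_add_right)

lemma nrm_sq: "(nrm x)\<^sup>2 = Re (ip x x)"
  by (simp add: hnorm_def ip_ge_0)

lemma nrm_ge_0 [simp]: "0 \<le> nrm x"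
  by (simp add: hnorm_def ip_ge_0)

lemma ip_self: "ip x x = of_real ((nrm x)\<^sup>2)"
proof -
  have "Im (ip x x) = 0"
    using arg_cong[OF ip_commute[of x x], of Im] by simp
  then show ?thesis by (simp add: nrm_sq complex_eq_iff del: of_real_power)
qed

lemma nrm_zero [simp]: "nrm 0 = 0"
  by (simp add: hnorm_def)

lemma nrm_eq_0 [simp]: "nrm x = 0 \<longleftrightarrow> x = 0"
  using ip_definite[of x] ip_self[of x] by auto

lemma nrm_scale: "nrm (sc a x) = cmod a * nrm x"
proof -
  have "(nrm (sc a x))\<^sup>2 = Re (a * cnj a * ip x x)"
    by (simp only: nrm_sq ip_scale_left ip_scale_right mult_ac)
  also have "\<dots> = (cmod a * nrm x)\<^sup>2"
    by (simp only: complex_norm_square[symmetric] ip_self power_mult_distrib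
        of_real_mult[symmetric] Re_complex_of_real)
  finally show ?thesis by (simp add: power2_eq_iff_nonneg)
qed

lemma nrm_minus [simp]: "nrm (- x) = nrm x"
  by (simp add: hnorm_def ip_minus_left ip_minus_right)

lemma nrm_minus_commute: "nrm (x - y) = nrm (y - x)"
  using nrm_minus[of "x - y"] by simp

lemma nrm_add_sq: "(nrm (x + y))\<^sup>2 = (nrm x)\<^sup>2 + (nrm y)\<^sup>2 + 2 * Re (ip x y)"
proof -
  have "Re (ip y x) = Re (ip x y)" by (subst ip_commute) simp
  then show ?thesis by (simp add: nrm_sq ip_add_left ip_add_right)
qed

lemma nrm_diff_sq: "(nrm (x - y))\<^sup>2 = (nrm x)\<^sup>2 + (nrm y)\<^sup>2 - 2 * Re (ip x y)"
  using nrm_add_sq[of x "- y"] by (simp add: ip_minus_right)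

text \<open>Pythagoras for removing the component of \<open>x\<close> along \<open>y\<close>.
  Non-negativity of the left side yields Cauchy-Schwarz, and the decrease on the right forces the
  remainder at a closest point to be orthogonal.\<close>

lemma nrm_diff_component:
  assumes "y \<noteq> 0"
  shows "(nrm (x - sc (ip x y / of_real ((nrm y)\<^sup>2)) y))\<^sup>2
    = (nrm x)\<^sup>2 - (cmod (ip x y))\<^sup>2 / (nrm y)\<^sup>2"
proof -
  let ?n = "(nrm y)\<^sup>2" and ?c = "ip x y"
  have n: "?n \<noteq> 0" using assms by simp
  have "Re (ip x (sc (?c / of_real ?n) y)) = Re (?c * cnj ?c / of_real ?n)"
    by (simp add: ip_scale_right mult.commute del: of_real_power)
  also have "\<dots> = (cmod ?c)\<^sup>2 / ?n"
    by (simp only: complex_norm_square[symmetric] of_real_divide[symmetric] Re_complex_of_real)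
  finally have 1: "Re (ip x (sc (?c / of_real ?n) y)) = (cmod ?c)\<^sup>2 / ?n" .
  have "(nrm (sc (?c / of_real ?n) y))\<^sup>2 = (cmod ?c / ?n)\<^sup>2 * ?n"
    by (simp add: nrm_scale norm_divide norm_power power_divide power_mult_distrib)
  also have "\<dots> = (cmod ?c)\<^sup>2 / ?n"
    using n by (simp add: power_divide power2_eq_square)
  finally show ?thesis by (simp only: nrm_diff_sq 1)
qed

lemma Cauchy_Schwarz: "cmod (ip x y) \<le> nrm x * nrm y"
proof (cases "y = 0")
  case False
  have "0 \<le> (nrm x)\<^sup>2 - (cmod (ip x y))\<^sup>2 / (nrm y)\<^sup>2"
    using nrm_diff_component[OF False, of x] by (metis zero_le_power2)
  then have "(cmod (ip x y))\<^sup>2 \<le> (nrm x * nrm y)\<^sup>2"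
    using False by (simp add: field_simps)
  then show ?thesis by (rule power2_le_imp_le) simp
qed simp

lemma nrm_triangle: "nrm (x + y) \<le> nrm x + nrm y"
proof (rule power2_le_imp_le)
  have "Re (ip x y) \<le> nrm x * nrm y"
    using Cauchy_Schwarz[of x y] complex_Re_le_cmod[of "ip x y"] by linarith
  then show "(nrm (x + y))\<^sup>2 \<le> (nrm x + nrm y)\<^sup>2"
    by (simp add: nrm_add_sq power2_sum)
qed simp

lemma nrm_diff_triangle: "nrm (x - z) \<le> nrm (x - y) + nrm (y - z)"
  using nrm_triangle[of "x - y" "y - z"] by simp

lemma nrm_diff_le: "nrm (x - y) \<le> nrm x + nrm y"
  using nrm_triangle[of x "- y"] by simp

lemma nrm_sum: "nrm (sum f S) \<le> (\<Sum>i\<in>S. nrm (f i))"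
proof (induction S rule: infinite_finite_induct)
  case (insert i S)
  then show ?case using nrm_triangle[of "f i" "sum f S"] by simp
qed auto

lemma nrm_sum_bound:
  assumes "\<And>i. i \<in> S \<Longrightarrow> nrm (f i) \<le> c"
  shows "nrm (sum f S) \<le> real (card S) * c"
  using order_trans[OF nrm_sum sum_bounded_above[of S "\<lambda>i. nrm (f i)" c]] assms by simp

lemma parallelogram: "(nrm (x + y))\<^sup>2 + (nrm (x - y))\<^sup>2 = 2 * (nrm x)\<^sup>2 + 2 * (nrm y)\<^sup>2"
  by (simp add: nrm_add_sq nrm_diff_sq)

text \<open>Expanding the squares leaves a double sum of inner products, which is the squared norm
  of the sum. The identity converts loss of norm under averaging into bounds on pairwise distances,
  and conversely.\<close>

lemma variance_identity:
  assumes "finite S"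
  shows "(\<Sum>i\<in>S. \<Sum>j\<in>S. (nrm (v i - v j))\<^sup>2)
    = 2 * (real (card S) * (\<Sum>i\<in>S. (nrm (v i))\<^sup>2) - (nrm (sum v S))\<^sup>2)"
proof -
  have "(\<Sum>i\<in>S. \<Sum>j\<in>S. (nrm (v i - v j))\<^sup>2)
      = (\<Sum>i\<in>S. \<Sum>j\<in>S. (nrm (v i))\<^sup>2) + (\<Sum>i\<in>S. \<Sum>j\<in>S. (nrm (v j))\<^sup>2)
        - 2 * (\<Sum>i\<in>S. \<Sum>j\<in>S. Re (ip (v i) (v j)))"
    by (simp add: nrm_diff_sq sum.distrib sum_subtractf sum_distrib_left)
  also have "(\<Sum>i\<in>S. \<Sum>j\<in>S. Re (ip (v i) (v j))) = (nrm (sum v S))\<^sup>2"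
    unfolding nrm_sq ip_sum_left ip_sum_right Re_sum by (rule sum.swap)
  finally show ?thesis by (simp add: sum_distrib_left algebra_simps)
qed

section \<open>Convergence in norm\<close>

lemma hconv_iff: "hconv ip X L \<longleftrightarrow> (\<forall>r>0. \<exists>M. \<forall>n\<ge>M. nrm (X n - L) < r)"
  unfolding hconv_def LIMSEQ_iff by simp

lemma hconvI_le:
  assumes "\<And>n. nrm (X n - L) \<le> f n" "f \<longlonglongrightarrow> 0"
  shows "hconv ip X L"
  unfolding hconv_def
  by (rule tendsto_sandwich[of "\<lambda>_. 0" _ _ f]) (use assms in auto)

lemma hconv_unique:
  assumes "hconv ip X L" "hconv ip X L'"
  shows "L = L'"
proof -
  have "(\<lambda>n. nrm (X n - L) + nrm (X n - L')) \<longlonglongrightarrow> 0 + 0"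
    using assms unfolding hconv_def by (intro tendsto_add)
  moreover have "nrm (L - L') \<le> nrm (X n - L) + nrm (X n - L')" for n
    using nrm_diff_triangle[of L L' "X n"] by (simp add: nrm_minus_commute)
  ultimately have "nrm (L - L') \<le> 0" by (intro LIMSEQ_le_const) auto
  then show ?thesis using nrm_ge_0[of "L - L'"] by (simp add: antisym)
qed

lemma hconv_add:
  assumes "hconv ip X L" "hconv ip Y K"
  shows "hconv ip (\<lambda>n. X n + Y n) (L + K)"
proof (rule hconvI_le)
  show "nrm (X n + Y n - (L + K)) \<le> nrm (X n - L) + nrm (Y n - K)" for n
    using nrm_triangle[of "X n - L" "Y n - K"] by (simp add: algebra_simps)
  show "(\<lambda>n. nrm (X n - L) + nrm (Y n - K)) \<longlonglongrightarrow> 0"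
    using tendsto_add assms unfolding hconv_def by fastforce
qed

lemma hconv_scale:
  assumes "hconv ip X L"
  shows "hconv ip (\<lambda>n. sc a (X n)) (sc a L)"
proof (rule hconvI_le)
  show "nrm (sc a (X n) - sc a L) \<le> cmod a * nrm (X n - L)" for n
    by (simp add: vs.scale_right_diff_distrib[symmetric] nrm_scale)
  show "(\<lambda>n. cmod a * nrm (X n - L)) \<longlonglongrightarrow> 0"
    using tendsto_mult_right_zero assms unfolding hconv_def by blast
qed

section \<open>Orthogonal projection onto the closure of a subspace\<close>

lemma closest_point_orthogonal:
  assumes S: "vs.subspace S"
    and p: "\<And>w. w \<in> S \<Longrightarrow> nrm (x - p) \<le> nrm (x - (p + w))"
    and w: "w \<in> S"
  shows "ip (x - p) w = 0"
proof (cases "w = 0")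
  case False
  let ?a = "ip (x - p) w / of_real ((nrm w)\<^sup>2)"
  \<comment> \<open>The competitor moves from \<open>p\<close> by the component of
    \<open>x - p\<close> along \<open>w\<close>; it would be strictly closer to \<open>x\<close>
    unless that component vanishes.\<close>
  have "nrm (x - p) \<le> nrm (x - (p + sc ?a w))"
    using S w by (intro p) (simp add: vs.subspace_scale)
  then have "(nrm (x - p))\<^sup>2 \<le> (nrm (x - p - sc ?a w))\<^sup>2"
    by (intro power_mono) (simp_all add: diff_diff_eq)
  then have "(cmod (ip (x - p) w))\<^sup>2 / (nrm w)\<^sup>2 \<le> 0"
    unfolding nrm_diff_component[OF False] by simp
  then have "(cmod (ip (x - p) w))\<^sup>2 \<le> 0"
    using False by (simp add: divide_le_0_iff)
  then show ?thesis by simp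
qed simp

text \<open>\<open>S\<close> may fail to be closed, so \<open>p\<close> is the limit of a minimizing
  sequence in \<open>S\<close>, and membership in the closure is expressed by approximation.\<close>

lemma orthogonal_projection_exists:
  assumes S: "vs.subspace S"
  obtains p where "\<And>r. r > 0 \<Longrightarrow> \<exists>w\<in>S. nrm (p - w) < r" "\<And>w. w \<in> S \<Longrightarrow> ip (x - p) w = 0"
proof -
  define d where "d = (INF w\<in>S. nrm (x - w))"
  have S0: "0 \<in> S" using S by (rule vs.subspace_0)
  have bdd: "bdd_below ((\<lambda>w. nrm (x - w)) ` S)" by (rule bdd_belowI[of _ 0]) auto
  have d_le: "d \<le> nrm (x - w)" if "w \<in> S" for w
    unfolding d_def using that bdd by (rule cINF_lower[rotated])
  have d0: "0 \<le> d" unfolding d_def using S0 by (intro cINF_greatest) auto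
  have "\<exists>w\<in>S. nrm (x - w) < d + 1 / real (Suc n)" for n
    using cINF_less_iff[of S "\<lambda>w. nrm (x - w)" "d + 1 / real (Suc n)"] S0 bdd
    by (auto simp: d_def)
  then obtain w where w: "\<And>n. w n \<in> S" "\<And>n. nrm (x - w n) < d + 1 / real (Suc n)"
    by metis
  \<comment> \<open>The midpoint of \<open>w m\<close> and \<open>w n\<close> lies in
    \<open>S\<close>, hence at distance at least \<open>d\<close> from \<open>x\<close>; the
    parallelogram law then makes \<open>w m - w n\<close> small. The constant comes from
    \<open>8 * d * \<eta> + 4 * \<eta>\<^sup>2\<close> and \<open>\<eta> \<le> 1\<close>.\<close>
  have gap: "(nrm (w m - w n))\<^sup>2 \<le> (8 * d + 4) / real (Suc M)" if "M \<le> m" "M \<le> n" for m n M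
  proof -
    define \<eta> where "\<eta> = 1 / real (Suc M)"
    have \<eta>: "0 \<le> \<eta>" "\<eta> \<le> 1" by (auto simp: \<eta>_def)
    have le: "(nrm (x - w k))\<^sup>2 \<le> (d + \<eta>)\<^sup>2" if "M \<le> k" for k
    proof (rule power_mono)
      have "1 / real (Suc k) \<le> \<eta>" unfolding \<eta>_def using that by (intro divide_left_mono) auto
      then show "nrm (x - w k) \<le> d + \<eta>" using w(2)[of k] by linarith
    qed simp
    have "sc (1/2) (w m + w n) \<in> S"
      using S w(1) by (intro vs.subspace_scale vs.subspace_add)
    then have "d \<le> nrm (x - sc (1/2) (w m + w n))" by (rule d_le)
    also have "x - sc (1/2) (w m + w n) = sc (1/2) ((x - w m) + (x - w n))"
    proof -
      have "sc (1/2) (x + x) = x"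
        by (simp add: vs.scale_right_distrib flip: vs.scale_left_distrib)
      then have "x - sc (1/2) (w m + w n) = sc (1/2) (x + x) - sc (1/2) (w m + w n)" by simp
      also have "\<dots> = sc (1/2) ((x - w m) + (x - w n))"
        by (simp add: vs.scale_right_diff_distrib[symmetric] algebra_simps)
      finally show ?thesis .
    qed
    finally have "2 * d \<le> nrm ((x - w m) + (x - w n))" by (simp add: nrm_scale)
    then have "(2 * d)\<^sup>2 \<le> (nrm ((x - w m) + (x - w n)))\<^sup>2"
      using d0 by (intro power_mono) auto
    then have "(nrm ((x - w m) - (x - w n)))\<^sup>2 \<le> 4 * (d + \<eta>)\<^sup>2 - (2 * d)\<^sup>2"
      using parallelogram[of "x - w m" "x - w n"] le[OF that(1)] le[OF that(2)] by linarith
    also have "\<dots> = 8 * d * \<eta> + 4 * \<eta> * \<eta>" by (simp add: power2_eq_square algebra_simps)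
    also have "\<dots> \<le> 8 * d * \<eta> + 4 * 1 * \<eta>" using \<eta> by (intro add_left_mono mult_right_mono) auto
    finally show ?thesis by (simp add: nrm_minus_commute \<eta>_def add_divide_distrib)
  qed
  have "\<exists>L. hconv ip w L"
  proof (rule complete)
    fix r :: real assume r: "r > 0"
    obtain M :: nat where M: "(8 * d + 4) / r\<^sup>2 < real M" using reals_Archimedean2 by blast
    have "nrm (w m - w n) < r" if "M \<le> m" "M \<le> n" for m n
    proof (rule power2_less_imp_less)
      have "(8 * d + 4) / real (Suc M) < r\<^sup>2"
        using M r by (simp add: field_simps) (smt (verit) zero_less_power mult_nonneg_nonneg d0)
      then show "(nrm (w m - w n))\<^sup>2 < r\<^sup>2" using gap[OF that] by linarith
    qed (use r in simp)
    then show "\<exists>M. \<forall>m\<ge>M. \<forall>n\<ge>M. nrm (w m - w n) < r" by blast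
  qed
  then obtain p where p: "hconv ip w p" by blast
  have close: "\<exists>v\<in>S. nrm (p - v) < r" if "r > 0" for r
    using p that w(1) unfolding hconv_iff by (metis nrm_minus_commute order_refl)
  have "nrm (x - p) \<le> d + 0 + 0"
  proof (rule LIMSEQ_le_const)
    show "(\<lambda>n. d + 1 / real (Suc n) + nrm (w n - p)) \<longlonglongrightarrow> d + 0 + 0"
      using p LIMSEQ_inverse_real_of_nat unfolding hconv_def
      by (intro tendsto_intros) (auto simp: inverse_eq_divide)
    show "\<exists>N. \<forall>n\<ge>N. nrm (x - p) \<le> d + 1 / real (Suc n) + nrm (w n - p)"
    proof (intro exI allI impI)
      fix n
      show "nrm (x - p) \<le> d + 1 / real (Suc n) + nrm (w n - p)"
        using w(2)[of n] nrm_diff_triangle[of x p "w n"] by linarith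
    qed
  qed
  \<comment> \<open>\<open>p + v\<close> is only a limit of points of \<open>S\<close>, so
    \<open>p\<close> is replaced by a nearby \<open>u\<close> in \<open>S\<close> and the error is
    sent to 0.\<close>
  moreover have "d \<le> nrm (x - (p + v))" if "v \<in> S" for v
  proof (rule field_le_epsilon)
    fix r :: real assume "r > 0"
    then obtain u where u: "u \<in> S" "nrm (p - u) < r" using close by blast
    have "d \<le> nrm (x - (u + v))" using S u(1) that by (intro d_le vs.subspace_add)
    also have "\<dots> \<le> nrm (x - (p + v)) + nrm (p - u)"
      using nrm_diff_triangle[of x "u + v" "p + v"] by simp
    finally show "d \<le> nrm (x - (p + v)) + r" using u(2) by linarith
  qed
  ultimately have "nrm (x - p) \<le> nrm (x - (p + v))" if "v \<in> S" for v
    using that by force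
  then have "ip (x - p) v = 0" if "v \<in> S" for v
    using closest_point_orthogonal[OF S _ that] by blast
  then show thesis using that close by blast
qed

end

subsection \<open>Averages of powers of an isometry\<close>

text \<open>Any set of naturals that contains the differences of \<open>D\<close> and is closed under sums and
  differences contains their gcd; this replaces Bezout's identity for a whole set.\<close>
lemma Gcd_differences_in_closed:
  fixes J :: "nat set" and D :: "nat set"
  assumes add: "\<And>m n. m \<in> J \<Longrightarrow> n \<in> J \<Longrightarrow> m + n \<in> J"
    and diff: "\<And>m n. m \<in> J \<Longrightarrow> n \<in> J \<Longrightarrow> m \<le> n \<Longrightarrow> n - m \<in> J"
    and zero: "0 \<in> J"
    and D: "\<And>c d. c \<in> D \<Longrightarrow> d \<in> D \<Longrightarrow> c \<le> d \<Longrightarrow> d - c \<in> J"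
    and s: "int s = Gcd {int d - int d' | d d'. d \<in> D \<and> d' \<in> D}"
  shows "s \<in> J"
proof -
  have mult: "k * n \<in> J" if "n \<in> J" for k n
    using that by (induction k) (auto intro: zero add)
  have "\<exists>g\<in>J. \<forall>n\<in>J. g dvd n"
  proof (cases "\<exists>n\<in>J. n > 0")
    case True
    define g where "g = (LEAST n. n \<in> J \<and> n > 0)"
    have g: "g \<in> J" "g > 0" using LeastI_ex[of "\<lambda>n. n \<in> J \<and> n > 0"] True by (auto simp: g_def)
    have "g dvd n" if "n \<in> J" for n
    proof -
      have "n - n div g * g \<in> J" using that g mult by (intro diff) auto
      then have "n mod g \<in> J" by (simp add: minus_div_mult_eq_mod)
      then have "\<not> n mod g > 0"
        using not_less_Least[of "n mod g" "\<lambda>n. n \<in> J \<and> n > 0"] g(2) by (auto simp: g_def)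
      then show ?thesis by auto
    qed
    then show ?thesis using g(1) by blast
  next
    case False
    then show ?thesis using zero by (intro bexI[of _ 0]) auto
  qed
  then obtain g where g: "g \<in> J" "\<And>n. n \<in> J \<Longrightarrow> g dvd n" by blast
  have "int g dvd int d - int d'" if "d \<in> D" "d' \<in> D" for d d'
  proof (cases "d' \<le> d")
    case True
    then have "int g dvd int (d - d')"
      using g(2)[OF D[OF that(2,1)]] by (simp only: int_dvd_int_iff)
    then show ?thesis using True by (simp only: of_nat_diff)
  next
    case False
    then have "int g dvd int (d' - d)"
      using g(2)[OF D[OF that]] by (simp only: int_dvd_int_iff nle_le)
    then show ?thesis using False by (subst dvd_diff_commute) (simp only: of_nat_diff nle_le)
  qed
  then have "int g dvd int s" unfolding s by (intro Gcd_greatest) auto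
  then obtain k where "s = k * g" by (metis dvd_def int_dvd_int_iff mult.commute)
  then show ?thesis using mult g(1) by simp
qed

context hilbert
begin

definition lin :: "('h \<Rightarrow> 'h) \<Rightarrow> bool" where
  "lin f \<longleftrightarrow> (\<forall>x y. f (x + y) = f x + f y) \<and> (\<forall>a x. f (sc a x) = sc a (f x))"

definition isom :: "('h \<Rightarrow> 'h) \<Rightarrow> bool" where
  "isom f \<longleftrightarrow> lin f \<and> (\<forall>x y. ip (f x) (f y) = ip x y)"

text \<open>Indexing by a set covers both the digit averages (\<open>S = D\<close>) and the ergodic
  averages (\<open>S = {..<N}\<close>). If \<open>card S = 0\<close>, division by zero makes the
  value 0.\<close>

definition avg :: "('h \<Rightarrow> 'h) \<Rightarrow> nat set \<Rightarrow> 'h \<Rightarrow> 'h" where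
  "avg f S x = sc (1 / of_nat (card S)) (\<Sum>i\<in>S. (f ^^ i) x)"

lemma lin_add: "lin f \<Longrightarrow> f (x + y) = f x + f y"
  and lin_scale: "lin f \<Longrightarrow> f (sc a x) = sc a (f x)"
  by (auto simp: lin_def)

lemma lin_zero: "lin f \<Longrightarrow> f 0 = 0"
  using lin_scale[of f 0 0] by simp

lemma lin_diff: "lin f \<Longrightarrow> f (x - y) = f x - f y"
  using lin_add[of f "x - y" y] by simp

lemma lin_sum: "lin f \<Longrightarrow> f (sum g S) = (\<Sum>i\<in>S. f (g i))"
  by (induction S rule: infinite_finite_induct) (auto simp: lin_add lin_zero)

lemma isom_lin: "isom f \<Longrightarrow> lin f"
  by (simp add: isom_def)

lemma isom_ip: "isom f \<Longrightarrow> ip (f x) (f y) = ip x y"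
  by (simp add: isom_def)

lemma isom_nrm: "isom f \<Longrightarrow> nrm (f x) = nrm x"
  by (simp add: hnorm_def isom_ip)

lemma isom_comp: "isom f \<Longrightarrow> isom g \<Longrightarrow> isom (f \<circ> g)"
  by (simp add: isom_def lin_def)

lemma isom_id: "isom id"
  by (simp add: isom_def lin_def)

lemma isom_funpow: "isom f \<Longrightarrow> isom (f ^^ n)"
  by (induction n) (auto simp: isom_id isom_comp simp del: id_apply)

lemma isom_funpow_diff:
  assumes "isom f" "i \<le> j"
  shows "nrm ((f ^^ i) x - (f ^^ j) x) = nrm ((f ^^ (j - i)) x - x)"
proof -
  have "(f ^^ j) x = (f ^^ i) ((f ^^ (j - i)) x)"
    using assms(2) by (metis comp_apply funpow_add le_add_diff_inverse)
  then have "(f ^^ i) x - (f ^^ j) x = (f ^^ i) (x - (f ^^ (j - i)) x)"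
    using isom_lin[OF isom_funpow[OF assms(1)]] by (simp add: lin_diff)
  then show ?thesis
    using isom_nrm[OF isom_funpow[OF assms(1)]] by (simp add: nrm_minus_commute)
qed

lemma isom_funpow_displacement:
  assumes "isom f"
  shows "nrm ((f ^^ n) x - x) \<le> real n * nrm (f x - x)"
proof (induction n)
  case (Suc n)
  have "nrm ((f ^^ Suc n) x - x) \<le> nrm ((f ^^ Suc n) x - (f ^^ n) x) + nrm ((f ^^ n) x - x)"
    by (rule nrm_diff_triangle)
  also have "nrm ((f ^^ Suc n) x - (f ^^ n) x) = nrm (f x - x)"
    using isom_funpow_diff[OF assms, of n "Suc n" x]
    by (simp add: nrm_minus_commute[of "(f ^^ Suc n) x"] del: funpow.simps) simp
  finally show ?case using Suc by (simp add: algebra_simps)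
qed simp

lemma lin_avg:
  assumes "lin f"
  shows "lin (avg f S)"
proof -
  have "lin (f ^^ i)" for i using assms by (induction i) (auto simp: lin_def)
  then show ?thesis
    by (simp add: lin_def avg_def sum.distrib vs.scale_right_distrib vs.scale_sum_right
        vs.scale_left_commute mult.commute)
qed

lemma lin_avg_commute:
  assumes "lin g" "\<And>x. g (f x) = f (g x)"
  shows "g (avg f S x) = avg f S (g x)"
proof -
  have "g ((f ^^ i) x) = (f ^^ i) (g x)" for i by (induction i) (auto simp: assms(2))
  then show ?thesis using assms(1) by (simp add: avg_def lin_scale lin_sum)
qed

lemma avg_fixed:
  assumes "f x = x" "finite S" "S \<noteq> {}"
  shows "avg f S x = x"
proof -
  have "(f ^^ i) x = x" for i using assms(1) by (induction i) auto
  then have "avg f S x = sc (1 / of_nat (card S)) (\<Sum>i\<in>S. sc 1 x)" by (simp add: avg_def)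
  also have "\<dots> = sc (1 / of_nat (card S) * of_nat (card S)) x"
    by (simp add: vs.scale_sum_left[symmetric] del: vs.scale_one)
  finally show ?thesis using assms(2,3) by simp
qed

lemma nrm_avg_le:
  assumes "isom f"
  shows "nrm (avg f S x) \<le> nrm x"
proof (cases "card S = 0")
  case False
  have "nrm (\<Sum>i\<in>S. (f ^^ i) x) \<le> real (card S) * nrm x"
    by (rule nrm_sum_bound) (simp add: isom_nrm[OF isom_funpow[OF assms]])
  then show ?thesis using False by (simp add: avg_def nrm_scale norm_divide field_simps)
qed (simp add: avg_def)

text \<open>All vectors \<open>(f ^^ i) x\<close> have the norm of \<open>x\<close>, so the variance
  identity measures the norm lost by averaging. It is used in both directions: small loss bounds
  displacements, and small displacements bound the loss.\<close>

lemma avg_variance: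
  assumes "isom f" "finite S" "S \<noteq> {}"
  shows "(\<Sum>i\<in>S. \<Sum>j\<in>S. (nrm ((f ^^ i) x - (f ^^ j) x))\<^sup>2)
    = 2 * (real (card S))\<^sup>2 * ((nrm x)\<^sup>2 - (nrm (avg f S x))\<^sup>2)"
proof -
  have "nrm (\<Sum>i\<in>S. (f ^^ i) x) = real (card S) * nrm (avg f S x)"
    using assms(2,3) by (simp add: avg_def nrm_scale norm_divide)
  then show ?thesis
    unfolding variance_identity[OF assms(2), of "\<lambda>i. (f ^^ i) x"]
    by (simp add: isom_nrm[OF isom_funpow[OF assms(1)]] power2_eq_square algebra_simps)
qed

text \<open>Any two of the first \<open>n\<close> powers move \<open>x\<close> apart by at most
  \<open>n\<close> single displacements; this bounds all terms of the variance sum, and the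
  remaining factor 2 is discarded.\<close>

lemma avg_defect_le:
  assumes "isom f" "n > 0"
  shows "(nrm x)\<^sup>2 - (nrm (avg f {..<n} x))\<^sup>2 \<le> (real n)\<^sup>2 * (nrm (f x - x))\<^sup>2"
proof -
  let ?\<delta> = "real n * nrm (f x - x)"
  have le: "nrm ((f ^^ i) x - (f ^^ j) x) \<le> ?\<delta>" if "i \<le> j" "j < n" for i j
  proof -
    have "nrm ((f ^^ i) x - (f ^^ j) x) \<le> real (j - i) * nrm (f x - x)"
      using isom_funpow_displacement[OF assms(1)] by (simp add: isom_funpow_diff[OF assms(1) that(1)])
    also have "\<dots> \<le> ?\<delta>" using that by (intro mult_right_mono) auto
    finally show ?thesis .
  qed
  have "nrm ((f ^^ i) x - (f ^^ j) x) \<le> ?\<delta>" if "i < n" "j < n" for i j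
    using le[of i j] le[of j i] that by (cases "i \<le> j") (auto simp: nrm_minus_commute)
  then have "(\<Sum>i<n. \<Sum>j<n. (nrm ((f ^^ i) x - (f ^^ j) x))\<^sup>2) \<le> (\<Sum>i<n. \<Sum>j<n. ?\<delta>\<^sup>2)"
    by (intro sum_mono power_mono) auto
  also have "\<dots> = (real n)\<^sup>2 * ?\<delta>\<^sup>2" by (simp add: power2_eq_square)
  finally have "2 * ((real n)\<^sup>2 * ((nrm x)\<^sup>2 - (nrm (avg f {..<n} x))\<^sup>2)) \<le> (real n)\<^sup>2 * ?\<delta>\<^sup>2"
    using assms(2) by (simp add: avg_variance[OF assms(1)] lessThan_empty_iff mult.assoc)
  then have "(real n)\<^sup>2 * (2 * ((nrm x)\<^sup>2 - (nrm (avg f {..<n} x))\<^sup>2)) \<le> (real n)\<^sup>2 * ?\<delta>\<^sup>2"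
    by (simp only: mult.left_commute)
  then have "2 * ((nrm x)\<^sup>2 - (nrm (avg f {..<n} x))\<^sup>2) \<le> ?\<delta>\<^sup>2"
    using assms(2) by simp
  moreover have "0 \<le> (nrm x)\<^sup>2 - (nrm (avg f {..<n} x))\<^sup>2"
    using nrm_avg_le[OF assms(1)] by (simp add: power_mono)
  moreover have "u \<le> v" if "2 * u \<le> v" "0 \<le> u" for u v :: real
    using that by linarith
  ultimately show ?thesis unfolding power_mult_distrib by blast
qed

text \<open>Each index below \<open>n * m\<close> is written as \<open>i * m + k\<close> with
  \<open>k < m\<close>; the inner sum over \<open>k\<close> is the same for every block
  \<open>i\<close>.\<close>

lemma avg_mult:
  assumes "lin f" "m > 0" "n > 0"
  shows "avg f {..<n * m} x = avg (f ^^ m) {..<n} (avg f {..<m} x)"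
proof -
  have lin: "lin (f ^^ k)" for k using assms(1) by (induction k) (auto simp: lin_def)
  have "(\<Sum>i<n * m. (f ^^ i) x) = (\<Sum>i<n. \<Sum>k=i * m..<i * m + m. (f ^^ k) x)"
    by (rule sum.nat_group[symmetric])
  also have "\<dots> = (\<Sum>i<n. \<Sum>k<m. (f ^^ (i * m + k)) x)"
  proof (rule sum.cong)
    show "(\<Sum>k=i * m..<i * m + m. (f ^^ k) x) = (\<Sum>k<m. (f ^^ (i * m + k)) x)" for i
      by (rule sum.reindex_bij_witness[of _ "\<lambda>k. i * m + k" "\<lambda>k. k - i * m"]) auto
  qed simp
  also have "\<dots> = (\<Sum>i<n. ((f ^^ m) ^^ i) (\<Sum>k<m. (f ^^ k) x))"
    by (simp add: funpow_mult lin_sum[OF lin] funpow_add mult.commute)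
  finally show ?thesis
    by (simp add: avg_def lin_scale[OF lin] funpow_mult vs.scale_sum_right[symmetric])
qed

text \<open>An average over \<open>b ^ n\<close> powers is an \<open>n\<close>-fold iterated average over \<open>b\<close> powers, so its
  defect is a sum of squared displacements rather than the square of their sum.\<close>
lemma avg_power_defect_le:
  assumes "isom f" "b > 0"
  shows "(nrm x)\<^sup>2 - (nrm (avg f {..<b ^ n} x))\<^sup>2
    \<le> (real b)\<^sup>2 * (\<Sum>j<n. (nrm ((f ^^ (b ^ j)) x - x))\<^sup>2)"
proof (induction n)
  case 0
  show ?case by (simp add: avg_def)
next
  case (Suc n)
  let ?F = "f ^^ (b ^ n)" and ?z = "avg f {..<b ^ n} x"
  have lin: "lin ?F" using assms(1) by (simp add: isom_lin isom_funpow)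
  have comm: "?F (f y) = f (?F y)" for y by (rule funpow_swap1[symmetric])
  have "nrm (?F ?z - ?z) = nrm (avg f {..<b ^ n} (?F x - x))"
    by (simp add: lin_avg_commute[of ?F f, OF lin comm] lin_diff[OF lin_avg[OF isom_lin[OF assms(1)]]])
  also have "\<dots> \<le> nrm (?F x - x)" by (rule nrm_avg_le[OF assms(1)])
  finally have le: "nrm (?F ?z - ?z) \<le> nrm (?F x - x)" .
  have "(nrm ?z)\<^sup>2 - (nrm (avg f {..<b ^ Suc n} x))\<^sup>2 \<le> (real b)\<^sup>2 * (nrm (?F ?z - ?z))\<^sup>2"
    using avg_defect_le[OF isom_funpow[OF assms(1), of "b ^ n"] assms(2), of ?z]
      avg_mult[OF isom_lin[OF assms(1)] _ assms(2), of "b ^ n"] assms(2) by simp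
  also have "\<dots> \<le> (real b)\<^sup>2 * (nrm (?F x - x))\<^sup>2"
    using le by (intro mult_left_mono power_mono) auto
  finally show ?case using Suc.IH by (simp add: distrib_left)
qed

section \<open>Mean ergodic theorem\<close>

lemma displacement_closure_orthogonal_fixed:
  assumes "isom f" "f u = u" "\<And>r. r > 0 \<Longrightarrow> \<exists>w. nrm (q - (f w - w)) < r"
  shows "ip q u = 0"
proof -
  have "cmod (ip q u) \<le> 0 + r" if "r > 0" for r
  proof -
    \<comment> \<open>The summand 1 keeps the denominator positive when
      \<open>u = 0\<close>.\<close>
    from that have "r / (nrm u + 1) > 0" by (simp add: add_nonneg_pos)
    then obtain w where w: "nrm (q - (f w - w)) < r / (nrm u + 1)" using assms(3) by blast
    \<comment> \<open>\<open>f\<close> preserves inner products and fixes \<open>u\<close>, so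
      \<open>ip (f w) u = ip w u\<close>.\<close>
    have "ip (f w - w) u = 0"
      using isom_ip[OF assms(1), of w u] assms(2) by (simp add: ip_diff_left)
    then have "cmod (ip q u) = cmod (ip (q - (f w - w)) u)" by (simp add: ip_diff_left)
    also have "\<dots> \<le> r / (nrm u + 1) * nrm u"
      using Cauchy_Schwarz w by (meson less_imp_le mult_right_mono nrm_ge_0 order_trans)
    also have "\<dots> \<le> r / (nrm u + 1) * (nrm u + 1)"
      using that by (intro mult_left_mono) (auto simp: add_nonneg_nonneg)
    also have "\<dots> = r" using add_nonneg_pos[OF nrm_ge_0[of u] zero_less_one] by simp
    finally show ?thesis by simp
  qed
  then show ?thesis using field_le_epsilon[of "cmod (ip q u)" 0] by auto
qed

lemma avg_displacement_le:
  assumes "isom f"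
  shows "nrm (avg f {..<N} (f w - w)) \<le> 2 * nrm w / real N"
proof -
  have "(\<Sum>i<N. (f ^^ i) (f w - w)) = (\<Sum>i<N. (f ^^ Suc i) w - (f ^^ i) w)"
    by (simp add: lin_diff[OF isom_lin[OF isom_funpow[OF assms]]] funpow_swap1)
  also have "\<dots> = (f ^^ N) w - w"
    using sum_lessThan_telescope[of "\<lambda>i. (f ^^ i) w" N] by simp
  finally have "nrm (avg f {..<N} (f w - w)) = nrm ((f ^^ N) w - w) / real N"
    by (simp add: avg_def nrm_scale norm_divide)
  also have "\<dots> \<le> 2 * nrm w / real N"
    using nrm_diff_le[of "(f ^^ N) w" w] isom_nrm[OF isom_funpow[OF assms]]
    by (intro divide_right_mono) auto
  finally show ?thesis .
qed

text \<open>Von Neumann's argument: \<open>x\<close> splits into \<open>q\<close> in the closure of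
  the displacements \<open>f w - w\<close> and a remainder \<open>p\<close> orthogonal to them.
  Averages of a displacement telescope and vanish in the limit.\<close>

lemma mean_ergodic:
  assumes f: "isom f"
  obtains p where "f p = p" "hconv ip (\<lambda>N. avg f {..<N} x) p"
    "\<And>r. r > 0 \<Longrightarrow> \<exists>w. nrm (x - p - (f w - w)) < r"
proof -
  let ?S = "range (\<lambda>w. f w - w)"
  have lin: "lin f" using f by (rule isom_lin)
  have "vs.subspace ?S"
  proof (rule vs.subspaceI)
    show "0 \<in> ?S" using lin_zero[OF lin] by (auto intro: image_eqI[of _ _ 0])
    show "u + v \<in> ?S" if uv: "u \<in> ?S" "v \<in> ?S" for u v
    proof -
      obtain u' v' where "u = f u' - u'" "v = f v' - v'" using uv by blast
      then have "u + v = f (u' + v') - (u' + v')" by (simp add: lin_add[OF lin])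
      then show ?thesis by blast
    qed
    show "sc c u \<in> ?S" if u: "u \<in> ?S" for c u
    proof -
      obtain u' where "u = f u' - u'" using u by blast
      then have "sc c u = f (sc c u') - sc c u'"
        by (simp add: lin_scale[OF lin] vs.scale_right_diff_distrib)
      then show ?thesis by blast
    qed
  qed
  then obtain q where q: "\<And>r. r > 0 \<Longrightarrow> \<exists>w\<in>?S. nrm (q - w) < r"
      "\<And>w. w \<in> ?S \<Longrightarrow> ip (x - q) w = 0"
    using orthogonal_projection_exists by blast
  define p where "p = x - q"
  \<comment> \<open>Orthogonality of \<open>p\<close> to its own displacement, together with equal
    norms of \<open>p\<close> and \<open>f p\<close>, gives \<open>f p = p\<close>.\<close>
  have "ip p (f p - p) = 0" unfolding p_def by (rule q(2)) simp
  then have "ip p (f p) = ip p p" by (simp add: ip_diff_right)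
  then have "(nrm (p - f p))\<^sup>2 = 0"
    unfolding nrm_diff_sq isom_nrm[OF f] by (simp add: nrm_sq)
  then have fp: "f p = p" by simp
  have close: "\<exists>w. nrm (q - (f w - w)) < r" if "r > 0" for r
    using q(1)[OF that] by blast
  have "hconv ip (\<lambda>N. avg f {..<N} x) p"
    unfolding hconv_iff
  proof (intro allI impI)
    fix r :: real assume r: "r > 0"
    then obtain w where w: "nrm (q - (f w - w)) < r / 2" using close[of "r / 2"] by auto
    obtain M :: nat where M: "4 * nrm w / r < real M" using reals_Archimedean2 by blast
    have "nrm (avg f {..<N} x - p) < r" if N: "N \<ge> Suc M" for N
    proof -
      have "avg f {..<N} x = avg f {..<N} p + avg f {..<N} (q - (f w - w)) + avg f {..<N} (f w - w)"
        by (simp add: lin_add[OF lin_avg[OF lin], symmetric] p_def)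
      also have "avg f {..<N} p = p" using N by (intro avg_fixed fp) (auto simp: lessThan_empty_iff)
      finally have "nrm (avg f {..<N} x - p)
          = nrm (avg f {..<N} (q - (f w - w)) + avg f {..<N} (f w - w))" by (simp add: add.assoc)
      also have "\<dots> \<le> nrm (avg f {..<N} (q - (f w - w))) + nrm (avg f {..<N} (f w - w))"
        by (rule nrm_triangle)
      also have "\<dots> \<le> nrm (q - (f w - w)) + 2 * nrm w / real N"
        by (intro add_mono nrm_avg_le avg_displacement_le f)
      also have "2 * nrm w / real N < r / 2"
      proof -
        have "4 * nrm w / r < real N" using M N by linarith
        then show ?thesis using r N by (simp add: field_simps)
      qed
      finally show ?thesis using w by linarith
    qed
    then show "\<exists>M. \<forall>n\<ge>M. nrm (avg f {..<n} x - p) < r" by blast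
  qed
  then show thesis using that[OF fp] close by (simp add: p_def)
qed

text \<open>The exponents whose displacement is controlled by the loss of norm contain the
  differences of \<open>D\<close> (variance identity) and are closed under sums and differences,
  hence contain \<open>s\<close>. The constant is uniform in \<open>f\<close> and \<open>y\<close>,
  so that it serves all \<open>Z j\<close> at once.\<close>

lemma Gcd_displacement_le:
  fixes D :: "nat set"
  assumes D: "finite D" "D \<noteq> {}"
    and s: "int s = Gcd {int d - int d' | d d'. d \<in> D \<and> d' \<in> D}"
  obtains C where "C \<ge> 0"
    "\<And>f y. isom f \<Longrightarrow> (nrm ((f ^^ s) y - y))\<^sup>2 \<le> C * ((nrm y)\<^sup>2 - (nrm (avg f D y))\<^sup>2)"
proof -
  \<comment> \<open>With the square root of the loss, the triangle inequality simply adds constants;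
    squaring is postponed to the end.\<close>
  define \<delta> where "\<delta> f y = sqrt ((nrm y)\<^sup>2 - (nrm (avg f D y))\<^sup>2)" for f y
  have \<delta>0: "0 \<le> (nrm y)\<^sup>2 - (nrm (avg f D y))\<^sup>2" if "isom f" for f y
    using nrm_avg_le[OF that, of D y] by (simp add: power_mono)
  define J where "J = {n. \<exists>C\<ge>0. \<forall>f y. isom f \<longrightarrow> nrm ((f ^^ n) y - y) \<le> C * \<delta> f y}"
  have "s \<in> J"
  proof (rule Gcd_differences_in_closed[OF _ _ _ _ s])
    show "0 \<in> J" unfolding J_def by (auto intro!: exI[of _ 0])
    show "m + n \<in> J" if mn: "m \<in> J" "n \<in> J" for m n
    proof -
      obtain C K where CK: "C \<ge> 0" "K \<ge> 0"
          "\<And>f y. isom f \<Longrightarrow> nrm ((f ^^ m) y - y) \<le> C * \<delta> f y"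
          "\<And>f y. isom f \<Longrightarrow> nrm ((f ^^ n) y - y) \<le> K * \<delta> f y"
        using mn unfolding J_def by blast
      have "nrm ((f ^^ (m + n)) y - y) \<le> (C + K) * \<delta> f y" if f: "isom f" for f y
      proof -
        have "nrm ((f ^^ (m + n)) y - y)
            \<le> nrm ((f ^^ (m + n)) y - (f ^^ m) y) + nrm ((f ^^ m) y - y)"
          by (rule nrm_diff_triangle)
        also have "nrm ((f ^^ (m + n)) y - (f ^^ m) y) = nrm ((f ^^ n) y - y)"
          using isom_funpow_diff[OF f, of m "m + n" y] by (simp add: nrm_minus_commute)
        finally show ?thesis using CK(3,4)[OF f, of y] by (simp add: distrib_right)
      qed
      then show ?thesis using CK(1,2) unfolding J_def
        by (intro CollectI exI[of _ "C + K"]) auto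
    qed
    show "n - m \<in> J" if mn: "m \<in> J" "n \<in> J" "m \<le> n" for m n
    proof -
      obtain C K where CK: "C \<ge> 0" "K \<ge> 0"
          "\<And>f y. isom f \<Longrightarrow> nrm ((f ^^ m) y - y) \<le> C * \<delta> f y"
          "\<And>f y. isom f \<Longrightarrow> nrm ((f ^^ n) y - y) \<le> K * \<delta> f y"
        using mn unfolding J_def by blast
      have "nrm ((f ^^ (n - m)) y - y) \<le> (C + K) * \<delta> f y" if f: "isom f" for f y
      proof -
        have "nrm ((f ^^ (n - m)) y - y) = nrm ((f ^^ m) y - (f ^^ n) y)"
          by (rule isom_funpow_diff[OF f mn(3), symmetric])
        also have "\<dots> \<le> nrm ((f ^^ m) y - y) + nrm ((f ^^ n) y - y)"
          using nrm_diff_triangle[of "(f ^^ m) y" "(f ^^ n) y" y]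
          by (simp add: nrm_minus_commute)
        finally show ?thesis using CK(3,4)[OF f, of y] by (simp add: distrib_right)
      qed
      then show ?thesis using CK(1,2) unfolding J_def
        by (intro CollectI exI[of _ "C + K"]) auto
    qed
    show "d - c \<in> J" if cd: "c \<in> D" "d \<in> D" "c \<le> d" for c d
    proof -
      have "nrm ((f ^^ (d - c)) y - y) \<le> sqrt (2 * (real (card D))\<^sup>2) * \<delta> f y"
        if f: "isom f" for f y
      proof -
        have "(nrm ((f ^^ c) y - (f ^^ d) y))\<^sup>2 \<le> (\<Sum>j\<in>D. (nrm ((f ^^ c) y - (f ^^ j) y))\<^sup>2)"
          using D cd by (intro member_le_sum) auto
        also have "\<dots> \<le> (\<Sum>i\<in>D. \<Sum>j\<in>D. (nrm ((f ^^ i) y - (f ^^ j) y))\<^sup>2)"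
          using D cd by (intro member_le_sum[where f = "\<lambda>i. \<Sum>j\<in>D. _ i j"]) (auto intro: sum_nonneg)
        also have "\<dots> = 2 * (real (card D))\<^sup>2 * ((nrm y)\<^sup>2 - (nrm (avg f D y))\<^sup>2)"
          by (rule avg_variance[OF f D])
        finally have "nrm ((f ^^ c) y - (f ^^ d) y)
            \<le> sqrt (2 * (real (card D))\<^sup>2 * ((nrm y)\<^sup>2 - (nrm (avg f D y))\<^sup>2))"
          by (rule real_le_rsqrt)
        then show ?thesis
          unfolding isom_funpow_diff[OF f cd(3)] \<delta>_def real_sqrt_mult .
      qed
      then show ?thesis unfolding J_def
        by (intro CollectI exI[of _ "sqrt (2 * (real (card D))\<^sup>2)"]) auto
    qed
  qed
  then obtain C where C: "C \<ge> 0" "\<And>f y. isom f \<Longrightarrow> nrm ((f ^^ s) y - y) \<le> C * \<delta> f y"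
    unfolding J_def by blast
  show thesis
  proof (rule that[of "C\<^sup>2"])
    fix f :: "'h \<Rightarrow> 'h" and y assume f: "isom f"
    have "(nrm ((f ^^ s) y - y))\<^sup>2 \<le> (C * \<delta> f y)\<^sup>2"
      using C(2)[OF f] by (intro power_mono) auto
    then show "(nrm ((f ^^ s) y - y))\<^sup>2 \<le> C\<^sup>2 * ((nrm y)\<^sup>2 - (nrm (avg f D y))\<^sup>2)"
      using \<delta>0[OF f] by (simp add: power_mult_distrib \<delta>_def)
  qed simp
qed

end

subsection \<open>Integers with digits in a given set\<close>

text \<open>Digit strings of fixed length \<open>m\<close>. The recursion adds the leading digit,
  matching the order in which \<open>B\<close> applies its averages.\<close>

fun digit_sums :: "nat \<Rightarrow> nat set \<Rightarrow> nat \<Rightarrow> nat set" where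
  "digit_sums b D 0 = {0}"
| "digit_sums b D (Suc m) = (\<lambda>(r, d). r + b ^ m * d) ` (digit_sums b D m \<times> D)"

lemma digit_sums_eq: "digit_sums b D m = {(\<Sum>j<m. d j * b ^ j) | d. \<forall>j<m. d j \<in> D}"
proof (induction m)
  case (Suc m)
  show ?case
  proof (intro equalityI subsetI)
    fix k assume "k \<in> digit_sums b D (Suc m)"
    then obtain d c where d: "\<forall>j<m. d j \<in> D" "c \<in> D" "k = (\<Sum>j<m. d j * b ^ j) + b ^ m * c"
      using Suc by auto
    let ?d = "d(m := c)"
    have "k = (\<Sum>j<Suc m. ?d j * b ^ j)" using d(3) by (simp add: mult.commute)
    moreover have "\<forall>j<Suc m. ?d j \<in> D" using d by (auto simp: less_Suc_eq)
    ultimately show "k \<in> {(\<Sum>j<Suc m. d j * b ^ j) | d. \<forall>j<Suc m. d j \<in> D}" by blast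
  next
    fix k assume "k \<in> {(\<Sum>j<Suc m. d j * b ^ j) | d. \<forall>j<Suc m. d j \<in> D}"
    then obtain d where d: "\<forall>j<Suc m. d j \<in> D" "k = (\<Sum>j<Suc m. d j * b ^ j)" by blast
    have "(\<Sum>j<m. d j * b ^ j) \<in> digit_sums b D m" using d(1) Suc by auto
    then show "k \<in> digit_sums b D (Suc m)"
      using d by (auto intro!: image_eqI[of _ _ "(\<Sum>j<m. d j * b ^ j, d m)"])
  qed
qed simp

text \<open>The index \<open>Suc m\<close> excludes the empty string: 0 belongs to the digit set
  only if \<open>0 \<in> D\<close>.\<close>

lemma digit_set_eq: "digit_set b D = (\<Union>m. digit_sums b D (Suc m))"
  unfolding digit_set_def digit_sums_eq lessThan_Suc_atMost less_Suc_eq_le by blast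

text \<open>A string of \<open>m + l\<close> digits is cut into its \<open>m\<close> low digits
  \<open>r\<close> and its \<open>l\<close> leading digits \<open>c\<close>.\<close>

lemma digit_sums_add:
  "k \<in> digit_sums b D (m + l) \<longleftrightarrow> (\<exists>r\<in>digit_sums b D m. \<exists>c\<in>digit_sums b D l. k = r + b ^ m * c)"
proof (induction l arbitrary: k)
  case (Suc l)
  have "k \<in> digit_sums b D (m + Suc l)
      \<longleftrightarrow> (\<exists>k'\<in>digit_sums b D (m + l). \<exists>d\<in>D. k = k' + b ^ (m + l) * d)" by auto
  also have "\<dots> \<longleftrightarrow> (\<exists>r\<in>digit_sums b D m. \<exists>c\<in>digit_sums b D l. \<exists>d\<in>D.
      k = (r + b ^ m * c) + b ^ (m + l) * d)"
    unfolding Bex_def Suc by blast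
  also have "\<dots> \<longleftrightarrow> (\<exists>r\<in>digit_sums b D m. \<exists>c\<in>digit_sums b D (Suc l). k = r + b ^ m * c)"
    by (auto simp: power_add algebra_simps)
  finally show ?case .
qed simp

locale digits =
  fixes b s :: nat and D :: "nat set"
  assumes b: "b \<ge> 3"
    and D: "D \<subseteq> {0..<b}" "2 \<le> card D"
    and s: "int s = Gcd {int d - int d' | d d'. d \<in> D \<and> d' \<in> D}"
    and s_dvd: "\<forall>d\<in>D. s dvd d"
begin

abbreviation C :: "nat set" where "C \<equiv> digit_set b D"
abbreviation R :: "nat \<Rightarrow> nat set" where "R \<equiv> digit_sums b D"

lemma finite_D: "finite D" and D_nonempty: "D \<noteq> {}" and D_less: "d \<in> D \<Longrightarrow> d < b"
  using D by (auto intro: finite_subset)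

lemma b_pos: "b > 0" and power_pos: "b ^ m > 0"
  using b by auto

lemma s_pos: "s > 0"
proof (rule ccontr)
  assume "\<not> s > 0"
  then have "Gcd {int d - int d' | d d'. d \<in> D \<and> d' \<in> D} = 0" using s by simp
  then have "{int d - int d' | d d'. d \<in> D \<and> d' \<in> D} \<subseteq> {0}" by (simp only: Gcd_0_iff)
  then have "d = d'" if "d \<in> D" "d' \<in> D" for d d' using that by force
  then have "card D \<le> Suc 0" by (subst card_le_Suc0_iff_eq[OF finite_D]) blast
  then show False using D(2) by simp
qed

lemma R_less: "r \<in> R m \<Longrightarrow> r < b ^ m"
proof (induction m arbitrary: r)
  case (Suc m)
  then obtain r' d where r: "r' \<in> R m" "d \<in> D" "r = r' + b ^ m * d" by auto
  have "r < b ^ m + b ^ m * d" using Suc.IH[OF r(1)] r(3) by simp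
  also have "\<dots> = b ^ m * Suc d" by simp
  also have "\<dots> \<le> b ^ m * b" using D_less[OF r(2)] by (intro mult_left_mono) auto
  finally show ?case by (simp add: mult.commute)
qed simp

lemma finite_R: "finite (R m)"
  by (rule finite_subset[of _ "{..<b ^ m}"]) (auto dest: R_less)

section \<open>Blocks with common leading digits\<close>

lemma block_inj: "inj_on (\<lambda>(c, r). r + b ^ m * c) (A \<times> R m)"
proof (rule inj_onI, clarify)
  fix c r c' r' assume "r \<in> R m" "r' \<in> R m" and eq: "r + b ^ m * c = r' + b ^ m * c'"
  then have lt: "r < b ^ m" "r' < b ^ m" by (auto dest: R_less)
  have "r = r'" using arg_cong[OF eq, of "\<lambda>n. n mod b ^ m"] lt by simp
  moreover have "c = c'" using arg_cong[OF eq, of "\<lambda>n. n div b ^ m"] lt power_pos[of m] by simp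
  ultimately show "c = c' \<and> r = r'" by simp
qed

lemma sum_R_Suc: "(\<Sum>r\<in>R (Suc m). f r) = (\<Sum>d\<in>D. \<Sum>r\<in>R m. f (r + b ^ m * d))"
proof -
  have "R (Suc m) = (\<lambda>(c, r). r + b ^ m * c) ` (D \<times> R m)" by (auto simp: image_iff)
  then show ?thesis
    by (simp only: sum.reindex[OF block_inj] sum.cartesian_product) (simp add: case_prod_unfold)
qed

lemma card_R: "card (R m) = card D ^ m"
proof (induction m)
  case (Suc m)
  have "card (R (Suc m)) = (\<Sum>r\<in>R (Suc m). 1)" by simp
  also have "\<dots> = card D * card (R m)" unfolding sum_R_Suc by simp
  finally show ?case using Suc by simp
qed simp

lemma block_in_C: "c \<in> C \<Longrightarrow> r \<in> R m \<Longrightarrow> r + b ^ m * c \<in> C"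
  unfolding digit_set_eq using digit_sums_add[of "r + b ^ m * c" b D m] by (metis UN_iff UNIV_I add_Suc_right)

text \<open>Strings of \<open>m\<close> digits stay below \<open>b ^ m\<close>, so \<open>k\<close>
  has more than \<open>m\<close> digits; at least one remains for \<open>c\<close>, which puts
  \<open>c\<close> in \<open>C\<close>.\<close>

lemma C_block:
  assumes "k \<in> C" "b ^ m \<le> k"
  obtains c r where "c \<in> C" "r \<in> R m" "k = r + b ^ m * c"
proof -
  obtain n where n: "k \<in> R (Suc n)" using assms(1) unfolding digit_set_eq by blast
  have "b ^ m < b ^ Suc n" using R_less[OF n] assms(2) by linarith
  then have "m < Suc n" using b power_less_imp_less_exp by (metis One_nat_def Suc_lessD Suc_le_lessD numeral_3_eq_3)
  then obtain l where "Suc n = m + Suc l" by (metis less_iff_Suc_add add_Suc_right)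
  then show thesis using that n digit_sums_add[of k b D m "Suc l"] unfolding digit_set_eq by auto
qed

lemma infinite_C: "infinite C"
proof -
  obtain d where d: "d \<in> D" "d > 0"
  proof (rule ccontr)
    assume "\<not> thesis"
    then have "D \<subseteq> {0}" using that by auto
    then have "card D \<le> card {0::nat}" by (intro card_mono) auto
    then show False using D(2) by simp
  qed
  have "\<exists>k\<in>C. m < k" for m
  proof -
    obtain r where r: "r \<in> R m" using card_R[of m] D(2) by fastforce
    then have "r + b ^ m * d \<in> R (Suc m)" using d by force
    moreover have "m < b ^ m" using b by (intro power_gt_expt) auto
    then have "m < r + b ^ m * d"
      using d(2) by (metis One_nat_def Suc_leI add.commute less_le_trans mult_le_mono2
          nat_mult_1_right trans_less_add1)
    ultimately show ?thesis unfolding digit_set_eq by blast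
  qed
  then show ?thesis by (auto simp: infinite_nat_iff_unbounded)
qed

section \<open>Sums of digits and initial segments\<close>

lemma digsum_rec: "digsum b n = n mod b + digsum b (n div b)"
  by (subst digsum.simps) (use b in auto)

lemma digsum_0 [simp]: "digsum b 0 = 0"
  by simp

text \<open>No carry occurs, because \<open>r\<close> occupies only the lowest \<open>m\<close>
  positions.\<close>

lemma digsum_block: "r < b ^ m \<Longrightarrow> digsum b (r + b ^ m * c) = digsum b r + digsum b c"
proof (induction m arbitrary: r)
  case (Suc m)
  have "(r + b ^ Suc m * c) mod b = r mod b"
    and div: "(r + b ^ Suc m * c) div b = r div b + b ^ m * c"
    using b by (simp_all add: mult.assoc)
  moreover have "r div b < b ^ m" using Suc.prems by (simp add: less_mult_imp_div_less mult.commute)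
  ultimately show ?case
    using Suc.IH[of "r div b"] digsum_rec[of "r + b ^ Suc m * c"] digsum_rec[of r]
    by (simp del: digsum.simps)
qed (simp del: digsum.simps)

lemma digsum_digit: "d \<in> D \<Longrightarrow> digsum b d = d"
  using D_less[of d] digsum_rec[of d] by (simp del: digsum.simps)

text \<open>The blocks cover the initial segment up to boundary terms: the numbers with few digits and
  the incomplete last block.\<close>
lemma initial_segment_blocks:
  defines "X K \<equiv> {k \<in> C. k < K}"
  defines "Y m K \<equiv> (\<lambda>(c, r). r + b ^ m * c) ` (X (K div b ^ m) \<times> R m)"
  shows "Y m K \<subseteq> X K" and "card (X K - Y m K) \<le> 2 * b ^ m"
proof -
  show sub: "Y m K \<subseteq> X K"
  proof
    fix k assume "k \<in> Y m K"
    then obtain c r where k: "c \<in> C" "c < K div b ^ m" "r \<in> R m" "k = r + b ^ m * c"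
      unfolding X_def Y_def by auto
    have "k < b ^ m * Suc c" using R_less[OF k(3)] k(4) by simp
    also have "\<dots> \<le> b ^ m * (K div b ^ m)" using k(2) by (intro mult_left_mono) auto
    also have "\<dots> \<le> K" by simp
    finally show "k \<in> X K" using block_in_C k unfolding X_def by simp
  qed
  have "X K - Y m K \<subseteq> {..<b ^ m} \<union> {b ^ m * (K div b ^ m)..<b ^ m * (K div b ^ m) + b ^ m}"
  proof
    fix k assume k: "k \<in> X K - Y m K"
    \<comment> \<open>Such a \<open>k\<close> has a leading part \<open>c\<close>, and since no
      complete block contains \<open>k\<close>, \<open>c\<close> is at least
      \<open>K div b ^ m\<close>.\<close>
    have "k \<ge> b ^ m * (K div b ^ m)" if ge: "b ^ m \<le> k"
    proof -
      obtain c r where c: "c \<in> C" "r \<in> R m" "k = r + b ^ m * c"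
        using k ge C_block unfolding X_def by blast
      then have "\<not> c < K div b ^ m" using k unfolding X_def Y_def by auto
      then show ?thesis using c(3) by (simp add: trans_le_add2)
    qed
    moreover have "K < b ^ m * (K div b ^ m) + b ^ m"
      using power_pos[of m] by (metis add.commute dividend_less_times_div)
    ultimately show "k \<in> {..<b ^ m} \<union> {b ^ m * (K div b ^ m)..<b ^ m * (K div b ^ m) + b ^ m}"
      using k unfolding X_def by force
  qed
  then have "card (X K - Y m K) \<le> card ({..<b ^ m} \<union> {b ^ m * (K div b ^ m)..<b ^ m * (K div b ^ m) + b ^ m})"
    by (intro card_mono) auto
  also have "\<dots> \<le> 2 * b ^ m" by (rule order_trans[OF card_Un_le]) simp
  finally show "card (X K - Y m K) \<le> 2 * b ^ m" .
qed

text \<open>The list in the theorem starts at \<open>n = 1\<close> but \<open>enumerate\<close>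
  starts at 0, hence \<open>n - 1\<close>; the first \<open>N\<close> elements are exactly those
  below \<open>enumerate C N\<close>.\<close>

lemma enumerate_initial_segment:
  "bij_betw (\<lambda>n. enumerate C (n - 1)) {1..N} {k \<in> C. k < enumerate C N}"
proof -
  have 1: "bij_betw (enumerate C) {..<N} {k \<in> C. k < enumerate C N}"
  proof (rule bij_betwI')
    show "enumerate C x = enumerate C y \<longleftrightarrow> x = y" for x y
      using strict_mono_enumerate[OF infinite_C] by (simp add: strict_mono_eq)
    show "enumerate C x \<in> {k \<in> C. k < enumerate C N}" if "x \<in> {..<N}" for x
      using that enumerate_in_set[OF infinite_C] enumerate_mono[OF _ infinite_C] by auto
    show "\<exists>x\<in>{..<N}. k = enumerate C x" if k: "k \<in> {k \<in> C. k < enumerate C N}" for k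
    proof -
      obtain x where x: "enumerate C x = k" using k enumerate_Ex infinite_C by blast
      then have "x < N" using k strict_mono_enumerate[OF infinite_C] by (auto simp: strict_mono_less)
      then show ?thesis using x by auto
    qed
  qed
  have 2: "bij_betw (\<lambda>n. n - 1) {1..N} {..<N}"
    by (rule bij_betw_byWitness[of _ Suc]) auto
  show ?thesis using bij_betw_trans[OF 2 1] by (simp only: comp_def)
qed

end

subsection \<open>Digit averages of commuting isometries\<close>

locale digit_operators = hilbert sc ip + digits b s D
  for sc :: "complex \<Rightarrow> 'h::ab_group_add \<Rightarrow> 'h" and ip :: "'h \<Rightarrow> 'h \<Rightarrow> complex"
    and b s :: nat and D :: "nat set" +
  fixes U V :: "'h \<Rightarrow> 'h"
  assumes isom_U: "isom U" and isom_V: "isom V" and U_V: "\<And>x. U (V x) = V (U x)"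
begin

definition Z :: "nat \<Rightarrow> 'h \<Rightarrow> 'h" where
  "Z j = (U ^^ (b ^ j)) \<circ> V"

definition W :: "nat \<Rightarrow> 'h \<Rightarrow> 'h" where
  "W j = Z j ^^ s"

definition V' :: "'h \<Rightarrow> 'h" where
  "V' = V ^^ (s * (b - 1))"

text \<open>The operator contributed by \<open>c\<close> when its digits occupy positions from
  \<open>j\<close> upwards; \<open>j = 0\<close> gives the summands of the theorem.\<close>

definition phase :: "nat \<Rightarrow> nat \<Rightarrow> 'h \<Rightarrow> 'h" where
  "phase j c x = (U ^^ (b ^ j * c)) ((V ^^ digsum b c) x)"

primrec B :: "nat \<Rightarrow> 'h \<Rightarrow> 'h" where
  "B 0 x = x"
| "B (Suc m) x = avg (Z m) D (B m x)"

text \<open>Such maps can be moved past every \<open>B m\<close>. Linearity instead of isometry is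
  required so that displacements \<open>f x - x\<close> are included.\<close>

definition commuting :: "('h \<Rightarrow> 'h) \<Rightarrow> bool" where
  "commuting f \<longleftrightarrow> lin f \<and> (\<forall>x. f (U x) = U (f x)) \<and> (\<forall>x. f (V x) = V (f x))"

lemma commuting_lin: "commuting f \<Longrightarrow> lin f"
  by (simp add: commuting_def)

lemma commuting_U_pow: "commuting f \<Longrightarrow> f ((U ^^ n) x) = (U ^^ n) (f x)"
  by (induction n) (auto simp: commuting_def)

lemma commuting_comp: "commuting f \<Longrightarrow> commuting g \<Longrightarrow> commuting (f \<circ> g)"
  by (simp add: commuting_def lin_def)

lemma commuting_id: "commuting id"
  by (simp add: commuting_def lin_def)

lemma commuting_funpow: "commuting f \<Longrightarrow> commuting (f ^^ n)"
  by (induction n) (auto simp: commuting_id commuting_comp simp del: id_apply)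

lemma commuting_U: "commuting U" and commuting_V: "commuting V"
  using isom_U isom_V U_V by (auto simp: commuting_def isom_def)

lemma commuting_Z: "commuting (Z j)"
  unfolding Z_def by (intro commuting_comp commuting_funpow commuting_U commuting_V)

lemma commuting_W: "commuting (W j)"
  unfolding W_def by (intro commuting_funpow commuting_Z)

lemma commuting_V': "commuting V'"
  unfolding V'_def by (intro commuting_funpow commuting_V)

lemma commuting_phase: "commuting (phase j c)"
  using commuting_comp[OF commuting_funpow[OF commuting_U] commuting_funpow[OF commuting_V]]
  unfolding phase_def comp_def .

lemma commuting_displacement: "commuting f \<Longrightarrow> commuting (\<lambda>x. f x - x)"
  using lin_diff[OF commuting_lin[OF commuting_U]] lin_diff[OF commuting_lin[OF commuting_V]]
  by (auto simp: commuting_def lin_def vs.scale_right_diff_distrib)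

lemma isom_Z: "isom (Z j)"
  unfolding Z_def by (intro isom_comp isom_funpow isom_U isom_V)

lemma isom_W: "isom (W j)"
  unfolding W_def by (intro isom_funpow isom_Z)

lemma isom_V': "isom V'"
  unfolding V'_def by (intro isom_funpow isom_V)

lemma isom_phase: "isom (phase j c)"
  using isom_comp[OF isom_funpow[OF isom_U] isom_funpow[OF isom_V]]
  unfolding phase_def comp_def .

lemma commuting_Z_apply: "commuting f \<Longrightarrow> f (Z j x) = Z j (f x)"
  unfolding Z_def by (simp add: commuting_U_pow) (simp add: commuting_def)

lemma commuting_Z_pow_apply: "commuting f \<Longrightarrow> f ((Z j ^^ n) x) = (Z j ^^ n) (f x)"
  by (induction n) (auto simp: commuting_Z_apply)

lemma commuting_avg_Z: "commuting f \<Longrightarrow> f (avg (Z j) S x) = avg (Z j) S (f x)"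
  by (rule lin_avg_commute) (auto intro: commuting_lin commuting_Z_apply)

lemma commuting_B: "commuting f \<Longrightarrow> f (B m x) = B m (f x)"
  by (induction m) (simp_all add: commuting_avg_Z)

lemma lin_B: "lin (B m)"
proof (induction m)
  case (Suc m)
  have "lin (avg (Z m) D)" by (intro lin_avg isom_lin isom_Z)
  with Suc show ?case by (simp add: lin_def)
qed (simp add: lin_def)

lemma nrm_B_antimono: "m \<le> n \<Longrightarrow> nrm (B n x) \<le> nrm (B m x)"
  by (induction n rule: dec_induct) (auto intro: order_trans[OF nrm_avg_le[OF isom_Z]])

lemma nrm_B_le: "nrm (B n x) \<le> nrm x"
  using nrm_B_antimono[of 0 n x] by simp

lemma Z_pow: "(Z j ^^ n) x = (U ^^ (b ^ j * n)) ((V ^^ n) x)"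
proof (induction n)
  case (Suc n)
  have "V ((U ^^ (b ^ j * n)) y) = (U ^^ (b ^ j * n)) (V y)" for y
    by (rule commuting_U_pow[OF commuting_V])
  then show ?case using Suc by (simp add: Z_def funpow_add)
qed simp

lemma Z_pow_phase: "d \<in> D \<Longrightarrow> (Z j ^^ d) x = phase j d x"
  by (simp add: Z_pow phase_def digsum_digit del: digsum.simps)

lemma phase_block:
  assumes "r \<in> R l"
  shows "phase j (r + b ^ l * c) x = phase (j + l) c (phase j r x)"
  unfolding phase_def digsum_block[OF R_less[OF assms]] commuting_U_pow[OF commuting_funpow[OF commuting_V]]
  by (simp add: funpow_add[THEN fun_cong, unfolded comp_apply, symmetric] power_add algebra_simps
      del: digsum.simps)

text \<open>The exponent of \<open>U\<close> is already that of \<open>W (Suc j)\<close>, while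
  \<open>V\<close> occurs \<open>s * b = s + s * (b - 1)\<close> times; the surplus is
  \<open>V'\<close>.\<close>

lemma W_pow_b: "(W j ^^ b) x = W (Suc j) (V' x)"
proof -
  have sb: "s * b = s + s * (b - 1)" using b by (cases b) auto
  have "(W j ^^ b) x = (U ^^ (b ^ j * (s * b))) ((V ^^ (s * b)) x)"
    by (simp add: W_def funpow_mult Z_pow)
  also have "\<dots> = (U ^^ (b ^ Suc j * s)) ((V ^^ s) (V' x))"
    unfolding V'_def by (subst (2) sb) (simp add: funpow_add mult_ac)
  also have "\<dots> = W (Suc j) (V' x)" by (simp add: W_def Z_pow)
  finally show ?thesis .
qed

lemma W_pow_b_pow:
  assumes "V' x = x"
  shows "(W j ^^ (b ^ i)) x = W (j + i) x"
proof (induction i)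
  case (Suc i)
  \<comment> \<open>The induction hypothesis holds at the vector \<open>x\<close> alone, so
    iterating it relies on commutation of the two operators.\<close>
  have *: "(W (j + i) ^^ n) x = ((W j ^^ (b ^ i)) ^^ n) x" for n
  proof (induction n)
    case (Suc n)
    have "(W (j + i) ^^ Suc n) x = (W (j + i) ^^ n) (W (j + i) x)" by (simp add: funpow_swap1)
    also have "\<dots> = (W (j + i) ^^ n) ((W j ^^ (b ^ i)) x)" using \<open>_ = W (j + i) x\<close> by simp
    also have "\<dots> = (W j ^^ (b ^ i)) ((W (j + i) ^^ n) x)"
      unfolding W_def by (simp add: funpow_mult commuting_Z_pow_apply[OF commuting_funpow[OF commuting_Z]])
    finally show ?case using Suc by simp
  qed simp
  have "(W j ^^ (b ^ Suc i)) x = ((W j ^^ (b ^ i)) ^^ b) x" by (simp add: funpow_mult mult.commute)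
  also have "\<dots> = W (Suc (j + i)) x" using W_pow_b[of "j + i" x] assms by (simp add: *)
  finally show ?case by simp
qed simp

section \<open>Decay of the digit averages\<close>

lemma displacement_B_le:
  obtains K where "K \<ge> 0" "\<And>j n x. j \<le> n \<Longrightarrow>
    (nrm (W j (B n x) - B n x))\<^sup>2 \<le> K * ((nrm (B j x))\<^sup>2 - (nrm (B (Suc j) x))\<^sup>2)"
proof -
  obtain K where K: "K \<ge> 0"
    "\<And>f y. isom f \<Longrightarrow> (nrm ((f ^^ s) y - y))\<^sup>2 \<le> K * ((nrm y)\<^sup>2 - (nrm (avg f D y))\<^sup>2)"
    using Gcd_displacement_le[OF finite_D D_nonempty s] by blast
  have "(nrm (W j (B n x) - B n x))\<^sup>2 \<le> K * ((nrm (B j x))\<^sup>2 - (nrm (B (Suc j) x))\<^sup>2)"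
    if "j \<le> n" for j n x
  proof -
    \<comment> \<open>Since the displacement commutes with \<open>B k\<close>, the averages after
      stage \<open>j\<close> can only shrink it; the bound at stage \<open>j\<close> thus persists
      for all \<open>n \<ge> j\<close>.\<close>
    have comm: "W j (B k x) - B k x = B k (W j x - x)" for k
      using commuting_B[OF commuting_displacement[OF commuting_W]] by blast
    have "(nrm (W j (B n x) - B n x))\<^sup>2 \<le> (nrm (W j (B j x) - B j x))\<^sup>2"
      unfolding comm using that by (intro power_mono nrm_B_antimono) auto
    also have "\<dots> \<le> K * ((nrm (B j x))\<^sup>2 - (nrm (B (Suc j) x))\<^sup>2)"
      using K(2)[OF isom_Z, of j "B j x"] by (simp add: W_def)
    finally show ?thesis .
  qed
  then show thesis using that K(1) by blast
qed

lemma nrm_B_sq_convergent: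
  obtains l where "(\<lambda>n. (nrm (B n x))\<^sup>2) \<longlonglongrightarrow> l" "l \<ge> 0" "\<And>n. l \<le> (nrm (B n x))\<^sup>2"
proof -
  have dec: "decseq (\<lambda>n. (nrm (B n x))\<^sup>2)"
    unfolding decseq_def using nrm_B_antimono by (auto intro!: power_mono)
  then obtain l where l: "(\<lambda>n. (nrm (B n x))\<^sup>2) \<longlonglongrightarrow> l" "\<And>n. l \<le> (nrm (B n x))\<^sup>2"
    using decseq_convergent[of "\<lambda>n. (nrm (B n x))\<^sup>2" 0] by auto
  moreover have "0 \<le> l" using l(1) by (rule LIMSEQ_le_const) auto
  ultimately show thesis using that by blast
qed

lemma V'_displacement_B_tendsto_0: "(\<lambda>n. nrm (V' (B n x) - B n x)) \<longlonglongrightarrow> 0"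
\<comment> \<open>With \<open>n = j + 2\<close>, the displacement bounds for \<open>W j\<close> and
  \<open>W (Suc j)\<close> both apply.\<close>
proof (rule LIMSEQ_offset[of _ 2])
  obtain K where K: "K \<ge> 0" "\<And>j n x. j \<le> n \<Longrightarrow>
      (nrm (W j (B n x) - B n x))\<^sup>2 \<le> K * ((nrm (B j x))\<^sup>2 - (nrm (B (Suc j) x))\<^sup>2)"
    using displacement_B_le by blast
  obtain l where l: "(\<lambda>n. (nrm (B n x))\<^sup>2) \<longlonglongrightarrow> l" using nrm_B_sq_convergent by blast
  define \<delta> where "\<delta> j = sqrt (K * ((nrm (B j x))\<^sup>2 - (nrm (B (Suc j) x))\<^sup>2))" for j
  have "(\<lambda>j. K * ((nrm (B j x))\<^sup>2 - (nrm (B (Suc j) x))\<^sup>2)) \<longlonglongrightarrow> K * (l - l)"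
    by (intro tendsto_intros l LIMSEQ_Suc[OF l])
  from tendsto_real_sqrt[OF this] have \<delta>: "\<delta> \<longlonglongrightarrow> 0" by (simp add: \<delta>_def[abs_def])
  have W: "nrm (W j (B n x) - B n x) \<le> \<delta> j" if "j \<le> n" for j n
    unfolding \<delta>_def using K(2)[OF that] by (rule real_le_rsqrt)
  show "(\<lambda>j. nrm (V' (B (j + 2) x) - B (j + 2) x)) \<longlonglongrightarrow> 0"
  proof (rule tendsto_sandwich[of "\<lambda>_. 0"])
    show "(\<lambda>j. real b * \<delta> j + \<delta> (Suc j)) \<longlonglongrightarrow> 0"
      using tendsto_add[OF tendsto_mult_right_zero[OF \<delta>] LIMSEQ_Suc[OF \<delta>]] by simp
    have "nrm (V' (B (j + 2) x) - B (j + 2) x) \<le> real b * \<delta> j + \<delta> (Suc j)" for j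
    proof -
      define y where "y = B (j + 2) x"
      \<comment> \<open>Applying the isometry \<open>W (Suc j)\<close> turns \<open>V' y\<close>
        into \<open>(W j ^^ b) y\<close>, so both vectors to be compared are close to
        \<open>y\<close>.\<close>
      have "nrm (V' y - y) = nrm (W (Suc j) (V' y) - W (Suc j) y)"
        using isom_nrm[OF isom_W, of "Suc j" "V' y - y"] by (simp add: lin_diff[OF isom_lin[OF isom_W]])
      also have "\<dots> = nrm ((W j ^^ b) y - W (Suc j) y)" by (simp add: W_pow_b)
      also have "\<dots> \<le> nrm ((W j ^^ b) y - y) + nrm (W (Suc j) y - y)"
        using nrm_diff_triangle[of "(W j ^^ b) y" "W (Suc j) y" y]
        by (simp add: nrm_minus_commute[of y])
      also have "\<dots> \<le> real b * nrm (W j y - y) + nrm (W (Suc j) y - y)"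
        using isom_funpow_displacement[OF isom_W] by simp
      also have "\<dots> \<le> real b * \<delta> j + \<delta> (Suc j)"
        unfolding y_def by (intro add_mono mult_left_mono W) auto
      finally show ?thesis unfolding y_def .
    qed
    then show "\<forall>\<^sub>F j in sequentially. nrm (V' (B (j + 2) x) - B (j + 2) x) \<le> real b * \<delta> j + \<delta> (Suc j)"
      by simp
  qed auto
qed

lemma B_tendsto_0_displacement_closure:
  assumes "\<And>r. r > 0 \<Longrightarrow> \<exists>w. nrm (q - (V' w - w)) < r"
  shows "(\<lambda>n. nrm (B n q)) \<longlonglongrightarrow> 0"
  unfolding LIMSEQ_iff
proof (intro allI impI)
  fix r :: real assume r: "r > 0"
  then obtain w where w: "nrm (q - (V' w - w)) < r / 2" using assms[of "r / 2"] by auto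
  obtain M where M: "\<And>n. n \<ge> M \<Longrightarrow> nrm (V' (B n w) - B n w) < r / 2"
    using LIMSEQ_D[OF V'_displacement_B_tendsto_0[of w], of "r / 2"] r by auto
  have "nrm (B n q) < r" if "n \<ge> M" for n
  proof -
    have "B n q = B n (q - (V' w - w)) + B n (V' w - w)" by (simp add: lin_add[OF lin_B, symmetric])
    also have "B n (V' w - w) = V' (B n w) - B n w"
      using commuting_B[OF commuting_displacement[OF commuting_V']] by simp
    finally have "nrm (B n q) \<le> nrm (B n (q - (V' w - w))) + nrm (V' (B n w) - B n w)"
      by (simp add: nrm_triangle)
    then show ?thesis using nrm_B_le[of n "q - (V' w - w)"] w M[OF that] by linarith
  qed
  then show "\<exists>M. \<forall>n\<ge>M. norm (nrm (B n q) - 0) < r" by auto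
qed

text \<open>\<open>V'\<close> commutes with the averages and fixes \<open>x\<close>, so it fixes the
  ergodic limit \<open>p\<close> as well. Then \<open>p\<close> is orthogonal to both
  \<open>x\<close> and \<open>x - p\<close>, hence zero.\<close>

lemma avg_W_tendsto_0:
  assumes x: "V' x = x" and orth: "\<And>u. V' u = u \<Longrightarrow> W m u = u \<Longrightarrow> ip x u = 0"
  shows "(\<lambda>N. nrm (avg (W m) {..<N} x)) \<longlonglongrightarrow> 0"
proof -
  obtain p where p: "W m p = p" "hconv ip (\<lambda>N. avg (W m) {..<N} x) p"
      "\<And>r. r > 0 \<Longrightarrow> \<exists>w. nrm (x - p - (W m w - w)) < r"
    using mean_ergodic[OF isom_W] by blast
  have V'W: "V' (W m y) = W m (V' y)" for y
    unfolding W_def by (rule commuting_Z_pow_apply[OF commuting_V'])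
  have "nrm (V' (avg (W m) {..<N} x) - V' p) = nrm (avg (W m) {..<N} x - p)" for N
    using isom_nrm[OF isom_V'] by (simp add: lin_diff[OF isom_lin[OF isom_V'], symmetric])
  moreover have "V' (avg (W m) {..<N} x) = avg (W m) {..<N} x" for N
    using lin_avg_commute[OF isom_lin[OF isom_V'], of "W m"] V'W x by simp
  ultimately have "hconv ip (\<lambda>N. avg (W m) {..<N} x) (V' p)"
    using p(2) unfolding hconv_def by simp
  then have "V' p = p" using p(2) by (rule hconv_unique)
  then have "ip x p = 0" using orth p(1) by blast
  moreover have "ip (x - p) p = 0"
    by (rule displacement_closure_orthogonal_fixed[OF isom_W p(1) p(3)])
  ultimately have "p = 0" by (intro ip_definite) (simp add: ip_diff_left)
  then show ?thesis using p(2) by (simp add: hconv_def)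
qed

lemma B_tendsto_0_fixed:
  assumes x: "V' x = x" and orth: "\<And>m u. V' u = u \<Longrightarrow> W m u = u \<Longrightarrow> ip x u = 0"
  shows "(\<lambda>n. nrm (B n x)) \<longlonglongrightarrow> 0"
proof -
  obtain K where K: "K \<ge> 0" "\<And>j n x. j \<le> n \<Longrightarrow>
      (nrm (W j (B n x) - B n x))\<^sup>2 \<le> K * ((nrm (B j x))\<^sup>2 - (nrm (B (Suc j) x))\<^sup>2)"
    using displacement_B_le by blast
  obtain l where l: "(\<lambda>n. (nrm (B n x))\<^sup>2) \<longlonglongrightarrow> l" "l \<ge> 0" using nrm_B_sq_convergent by blast
  have step: "(nrm (B (m + i) x))\<^sup>2 \<le> (nrm (avg (W m) {..<b ^ i} x))\<^sup>2
      + (real b)\<^sup>2 * (K * ((nrm (B m x))\<^sup>2 - (nrm (B (m + i) x))\<^sup>2))" for m i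
  proof -
    let ?y = "B (m + i) x"
    have V'y: "V' ?y = ?y" using commuting_B[OF commuting_V'] x by simp
    have comm: "avg (W m) {..<b ^ i} ?y = B (m + i) (avg (W m) {..<b ^ i} x)"
      by (rule lin_avg_commute[OF lin_B, symmetric]) (rule commuting_B[OF commuting_W, symmetric])
    have avg: "(nrm (avg (W m) {..<b ^ i} ?y))\<^sup>2 \<le> (nrm (avg (W m) {..<b ^ i} x))\<^sup>2"
      unfolding comm by (intro power_mono nrm_B_le) auto
    \<comment> \<open>On the \<open>V'\<close>-fixed vector \<open>?y\<close> the power
      \<open>b ^ j\<close> of \<open>W m\<close> acts as \<open>W (m + j)\<close>; the bounds are
      successive losses of norm, which telescope.\<close>
    have "(\<Sum>j<i. (nrm ((W m ^^ (b ^ j)) ?y - ?y))\<^sup>2)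
        \<le> (\<Sum>j<i. K * ((nrm (B (m + j) x))\<^sup>2 - (nrm (B (m + Suc j) x))\<^sup>2))"
    proof (rule sum_mono)
      fix j assume "j \<in> {..<i}"
      then show "(nrm ((W m ^^ (b ^ j)) ?y - ?y))\<^sup>2
          \<le> K * ((nrm (B (m + j) x))\<^sup>2 - (nrm (B (m + Suc j) x))\<^sup>2)"
        unfolding W_pow_b_pow[OF V'y] using K(2)[of "m + j" "m + i" x] by simp
    qed
    also have "\<dots> = K * ((nrm (B m x))\<^sup>2 - (nrm ?y)\<^sup>2)"
      using sum_lessThan_telescope'[of "\<lambda>j. (nrm (B (m + j) x))\<^sup>2" i]
      by (simp add: sum_distrib_left[symmetric])
    finally have "(real b)\<^sup>2 * (\<Sum>j<i. (nrm ((W m ^^ (b ^ j)) ?y - ?y))\<^sup>2)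
        \<le> (real b)\<^sup>2 * (K * ((nrm (B m x))\<^sup>2 - (nrm ?y)\<^sup>2))" by (intro mult_left_mono) auto
    then show ?thesis using avg_power_defect_le[OF isom_W b_pos, of ?y m i] avg by linarith
  qed
  \<comment> \<open>At fixed \<open>m\<close> the limit \<open>i \<rightarrow> \<infinity>\<close>
    removes the ergodic average; letting \<open>m\<close> grow afterwards removes the telescoped
    loss.\<close>
  have "l \<le> 0\<^sup>2 + (real b)\<^sup>2 * (K * ((nrm (B m x))\<^sup>2 - l))" for m
  proof (rule LIMSEQ_le)
    show "(\<lambda>i. (nrm (B (m + i) x))\<^sup>2) \<longlonglongrightarrow> l"
      using LIMSEQ_ignore_initial_segment[OF l(1), of m] by (simp add: add.commute)
    moreover have "(\<lambda>i. nrm (avg (W m) {..<b ^ i} x)) \<longlonglongrightarrow> 0"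
    proof -
      have "strict_mono (\<lambda>i. b ^ i)" using b by (intro strict_monoI power_strict_increasing) auto
      from LIMSEQ_subseq_LIMSEQ[OF avg_W_tendsto_0[OF x orth, of m] this]
      show ?thesis by (simp add: comp_def)
    qed
    ultimately show "(\<lambda>i. (nrm (avg (W m) {..<b ^ i} x))\<^sup>2
        + (real b)\<^sup>2 * (K * ((nrm (B m x))\<^sup>2 - (nrm (B (m + i) x))\<^sup>2)))
        \<longlonglongrightarrow> 0\<^sup>2 + (real b)\<^sup>2 * (K * ((nrm (B m x))\<^sup>2 - l))"
      by (intro tendsto_intros)
  qed (use step in blast)
  moreover have "(\<lambda>m. 0\<^sup>2 + (real b)\<^sup>2 * (K * ((nrm (B m x))\<^sup>2 - l)))
      \<longlonglongrightarrow> 0\<^sup>2 + (real b)\<^sup>2 * (K * (l - l))"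
    by (intro tendsto_intros l(1))
  ultimately have "l \<le> 0\<^sup>2 + (real b)\<^sup>2 * (K * (l - l))" by (intro LIMSEQ_le_const) auto
  then have "l = 0" using l(2) by simp
  from tendsto_real_sqrt[OF l(1)[unfolded this]] show ?thesis by simp
qed

lemma B_tendsto_0:
  assumes orth: "\<And>m u. V' u = u \<Longrightarrow> W m u = u \<Longrightarrow> ip x u = 0"
  shows "(\<lambda>n. nrm (B n x)) \<longlonglongrightarrow> 0"
proof -
  obtain p where p: "V' p = p" "\<And>r. r > 0 \<Longrightarrow> \<exists>w. nrm (x - p - (V' w - w)) < r"
    using mean_ergodic[OF isom_V'] by blast
  \<comment> \<open>\<open>x - p\<close> is approximated by displacements of \<open>V'\<close>,
    hence orthogonal to its fixed vectors, so \<open>p\<close> inherits the orthogonality of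
    \<open>x\<close>.\<close>
  have "ip p u = 0" if "V' u = u" "W m u = u" for m u
    using displacement_closure_orthogonal_fixed[OF isom_V' that(1) p(2)] orth[OF that]
    by (simp add: ip_diff_left)
  then have "(\<lambda>n. nrm (B n p)) \<longlonglongrightarrow> 0" using p(1) by (intro B_tendsto_0_fixed) auto
  moreover have "(\<lambda>n. nrm (B n (x - p))) \<longlonglongrightarrow> 0"
    by (rule B_tendsto_0_displacement_closure[OF p(2)])
  ultimately have lim: "(\<lambda>n. nrm (B n p) + nrm (B n (x - p))) \<longlonglongrightarrow> 0 + 0" by (rule tendsto_add)
  have "nrm (B n x - 0) \<le> nrm (B n p) + nrm (B n (x - p))" for n
    using nrm_triangle[of "B n p" "B n (x - p)"] lin_add[OF lin_B, of n p "x - p"] by simp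
  then have "hconv ip (\<lambda>n. B n x) 0"
    using lim unfolding add_0_left by (rule hconvI_le)
  then show ?thesis by (simp add: hconv_def)
qed

end

subsection \<open>Joint eigenvectors and convergence\<close>

lemma e_add: "e (x + y) = e x * e y"
  by (simp add: e_def cis_mult algebra_simps)

lemma e_power: "e x ^ n = e (real n * x)"
  by (simp add: e_def Complex.DeMoivre mult_ac)

lemma e_zero: "e 0 = 1"
  by (simp add: e_def)

lemma e_eq_1_iff: "e x = 1 \<longleftrightarrow> (\<exists>k::int. x = of_int k)"
proof -
  have "e x = 1 \<longleftrightarrow> (\<exists>k::int. 2 * pi * x = of_int (2 * k) * pi)"
    by (simp add: e_def cis_conv_exp exp_eq_1)
  also have "\<dots> \<longleftrightarrow> (\<exists>k::int. x = of_int k)" by (simp add: mult.commute)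
  finally show ?thesis .
qed

lemma sum_e_root_of_unity:
  assumes "i < n"
  shows "(\<Sum>k<n. e (- (real i * real k / real n))) = (if i = 0 then of_nat n else 0)"
proof (cases "i = 0")
  case False
  let ?z = "e (- (real i / real n))"
  have "?z \<noteq> 1"
  proof
    assume "?z = 1"
    then obtain k :: int where "- (real i / real n) = of_int k" unfolding e_eq_1_iff by blast
    then have "real i = of_int (- k * int n)" using assms by (simp add: field_simps)
    then have "int i = - k * int n" by linarith
    then have "int n dvd int i" by simp
    then show False using assms False by (auto dest: dvd_imp_le)
  qed
  moreover have "?z ^ n = 1"
    unfolding e_power e_eq_1_iff using assms by (intro exI[of _ "- int i"]) simp
  ultimately have "(\<Sum>k<n. ?z ^ k) = 0" by (simp add: sum_gp_strict)
  then show ?thesis using False by (simp add: e_power mult.commute)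
qed (simp add: e_zero)

section \<open>Finite Fourier decomposition\<close>

context hilbert
begin

text \<open>A discrete Fourier coefficient: if \<open>(f ^^ n) y = y\<close>, it is the component of
  \<open>y\<close> with eigenvalue \<open>e (k / n)\<close>.\<close>

definition eigencomponent :: "('h \<Rightarrow> 'h) \<Rightarrow> nat \<Rightarrow> nat \<Rightarrow> 'h \<Rightarrow> 'h" where
  "eigencomponent f n k y = sc (1 / of_nat n) (\<Sum>i<n. sc (e (- (real i * real k / real n))) ((f ^^ i) y))"

lemma eigencomponent_scale:
  assumes "lin f"
  shows "eigencomponent f n k (sc a y) = sc a (eigencomponent f n k y)"
proof -
  have "(f ^^ i) (sc a y) = sc a ((f ^^ i) y)" for i
    by (induction i) (auto simp: lin_scale[OF assms])
  then show ?thesis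
    by (simp add: eigencomponent_def vs.scale_sum_right mult_ac)
qed

lemma lin_eigencomponent_commute:
  assumes "lin g" "\<And>x. g (f x) = f (g x)"
  shows "g (eigencomponent f n k y) = eigencomponent f n k (g y)"
proof -
  have "g ((f ^^ i) x) = (f ^^ i) (g x)" for i x by (induction i) (auto simp: assms(2))
  then show ?thesis using assms(1) by (simp add: eigencomponent_def lin_scale lin_sum)
qed

text \<open>Applying \<open>f\<close> shifts the summation index and extracts the factor
  \<open>e (k / n)\<close>; periodicity closes the cycle.\<close>

lemma eigencomponent_eigenvector:
  assumes f: "lin f" and n: "n > 0" and y: "(f ^^ n) y = y"
  shows "f (eigencomponent f n k y) = sc (e (real k / real n)) (eigencomponent f n k y)"
proof -
  define g where "g i = sc (e (- (real i * real k / real n))) ((f ^^ i) y)" for i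
  have "e (- real k) = 1" unfolding e_eq_1_iff by (intro exI[of _ "- int k"]) simp
  then have "g n = g 0" using n y by (simp add: g_def e_zero)
  then have shift: "(\<Sum>i<n. g (Suc i)) = (\<Sum>i<n. g i)"
    using sum.lessThan_Suc_shift[of g n] by (simp add: add.commute)
  have "f (g i) = sc (e (real k / real n)) (g (Suc i))" for i
  proof -
    have "real k / real n + - (real (Suc i) * real k / real n) = - (real i * real k / real n)"
      by (simp add: algebra_simps add_divide_distrib)
    then show ?thesis by (simp add: g_def lin_scale[OF f] flip: e_add)
  qed
  then have "f (\<Sum>i<n. g i) = sc (e (real k / real n)) (\<Sum>i<n. g (Suc i))"
    by (simp add: lin_sum[OF f] vs.scale_sum_right)
  then show ?thesis
    unfolding eigencomponent_def g_def[symmetric] shift by (simp add: lin_scale[OF f] mult.commute)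
qed

lemma sum_eigencomponent:
  assumes "n > 0"
  shows "(\<Sum>k<n. eigencomponent f n k y) = y"
proof -
  have "(\<Sum>k<n. eigencomponent f n k y)
      = sc (1 / of_nat n) (\<Sum>i<n. \<Sum>k<n. sc (e (- (real i * real k / real n))) ((f ^^ i) y))"
    unfolding eigencomponent_def vs.scale_sum_right[symmetric] by (subst sum.swap) simp
  also have "\<dots> = sc (1 / of_nat n) (\<Sum>i<n. sc (if i = 0 then of_nat n else 0) ((f ^^ i) y))"
    by (simp add: vs.scale_sum_left[symmetric] sum_e_root_of_unity)
  also have "(\<Sum>i<n. sc (if i = 0 then of_nat n else 0) ((f ^^ i) y))
      = (\<Sum>i<n. if i = 0 then sc (of_nat n) y else 0)"
    by (intro sum.cong) auto
  finally show ?thesis using assms by simp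
qed

end

context digit_operators
begin

definition E :: "'h set" where
  "E = {y. y \<noteq> 0 \<and> (\<exists>\<alpha> \<beta> :: real. U y = sc (e \<alpha>) y \<and> V y = sc (e \<beta>) y \<and>
               (\<exists>(a::int) (r::int) (t::nat).
                  (\<exists>m::int. real s * \<alpha> = a / (real b - 1) + r / real b ^ t + m) \<and>
                  (\<exists>m::int. real s * \<beta> = - (a / (real b - 1)) + m)))}"

definition A :: "'h \<Rightarrow> nat \<Rightarrow> 'h" where
  "A = (\<lambda>x N. sc (1 / of_nat N) (\<Sum>n=1..N. (U ^^ enumerate (digit_set b D) (n - 1))
                ((V ^^ digsum b (enumerate (digit_set b D) (n - 1))) x)))"

lemma eigenvector_funpow:
  assumes "lin f" "f y = sc z y"
  shows "(f ^^ n) y = sc (z ^ n) y"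
  by (induction n) (auto simp: assms(2) lin_scale[OF assms(1)] mult.commute)

lemma W_eigenvector:
  assumes "U y = sc (e \<alpha>) y" "V y = sc (e \<beta>) y"
  shows "W j y = sc (e (real s * (real b ^ j * \<alpha> + \<beta>))) y"
proof -
  have "Z j y = sc (e (real b ^ j * \<alpha> + \<beta>)) y"
    using eigenvector_funpow[OF isom_lin[OF isom_U] assms(1), of "b ^ j"]
    by (simp add: Z_def assms(2) lin_scale[OF isom_lin[OF isom_funpow[OF isom_U]]] e_power e_add mult.commute)
  from eigenvector_funpow[OF isom_lin[OF isom_Z] this] show ?thesis
    unfolding W_def by (simp add: e_power)
qed

lemma power_minus_1_div: "\<exists>k::int. real b ^ m - 1 = (real b - 1) * k"
  using power_diff_1_eq[of "real b" m] by (intro exI[of _ "\<Sum>i<m. int b ^ i"]) simp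

text \<open>Fixedness under \<open>W m\<close> makes \<open>s * (b ^ m * \<alpha> + \<beta>)\<close>
  an integer \<open>N\<close>. With \<open>b ^ m - 1 = (b - 1) * k\<close>, solving for
  \<open>s * \<alpha>\<close> gives the witnesses \<open>a = - l\<close>,
  \<open>r = N + l * k\<close> and \<open>t = m\<close>.\<close>

lemma eigenvector_in_E:
  assumes y: "y \<noteq> 0" "U y = sc (e \<alpha>) y" "V y = sc (e \<beta>) y"
    and W: "W m y = y" and \<beta>: "real s * \<beta> = real l / (real b - 1)"
  shows "y \<in> E"
proof -
  have "sc (e (real s * (real b ^ m * \<alpha> + \<beta>)) - 1) y = 0"
    using W_eigenvector[OF y(2,3)] W by (simp add: vs.scale_left_diff_distrib)
  then have "e (real s * (real b ^ m * \<alpha> + \<beta>)) = 1" using y(1) by (simp add: vs.scale_eq_0_iff)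
  then obtain N :: int where N: "real s * (real b ^ m * \<alpha> + \<beta>) = N" unfolding e_eq_1_iff by blast
  obtain k :: int where k: "real b ^ m - 1 = (real b - 1) * k" using power_minus_1_div by blast
  have b1: "real b - 1 \<noteq> 0" "real b ^ m \<noteq> 0" using b by auto
  have bm: "real b ^ m = 1 + (real b - 1) * k" using k by linarith
  have "(real s * \<alpha>) * real b ^ m = N - real l / (real b - 1)" using N \<beta> by (simp add: algebra_simps)
  also have "\<dots> = - real l / (real b - 1) * real b ^ m + (N + int l * k)"
    using b1 by (subst bm) (simp add: field_simps)
  finally have "real s * \<alpha> = (- real l / (real b - 1) * real b ^ m + (N + int l * k)) / real b ^ m"
    using b1 by (simp add: field_simps)
  also have "\<dots> = - real l / (real b - 1) + (N + int l * k) / real b ^ m"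
    unfolding add_divide_distrib[of "_ * _"] nonzero_mult_div_cancel_right[OF b1(2)] ..
  finally have 1: "real s * \<alpha> = (- int l) / (real b - 1) + (N + int l * k) / real b ^ m + (0::int)" by simp
  have 2: "real s * \<beta> = - ((- int l) / (real b - 1)) + (0::int)" using \<beta> by simp
  show ?thesis unfolding E_def using y 1 2 by blast
qed

text \<open>Both \<open>U\<close> and \<open>V\<close> have finite order on \<open>u\<close>, so
  applying the Fourier decomposition twice writes \<open>u\<close> as a finite sum of joint
  eigenvectors.\<close>

lemma fixed_in_span_E:
  assumes V': "V' u = u" and W: "W m u = u"
  shows "u \<in> vs.span E"
proof -
  \<comment> \<open>\<open>(W m) ^^ (b - 1)\<close> is \<open>U ^^ M\<close> composed with
    \<open>V'\<close>, so \<open>U ^^ M\<close> fixes \<open>u\<close>.\<close>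
  define M where "M = s * b ^ m * (b - 1)"
  define M' where "M' = s * (b - 1)"
  have pos: "M > 0" "M' > 0" using s_pos b by (auto simp: M_def M'_def)
  have UM: "(U ^^ M) u = u"
  proof -
    have "(W m ^^ (b - 1)) u = (U ^^ M) (V' u)"
      by (simp add: W_def funpow_mult Z_pow V'_def M_def mult_ac)
    moreover have "(W m ^^ n) u = u" for n using W by (induction n) auto
    ultimately show ?thesis using V' by simp
  qed
  have W_U: "W m (U x) = U (W m x)" and W_V: "W m (V x) = V (W m x)"
    and V'_U: "V' (U x) = U (V' x)" for x
    using commuting_W commuting_V' by (auto simp: commuting_def)
  let ?u = "\<lambda>k l. eigencomponent V M' l (eigencomponent U M k u)"
  have "?u k l \<in> vs.span E" if "k < M" "l < M'" for k l
  \<comment> \<open>Components may vanish, and \<open>E\<close> contains only nonzero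
    vectors.\<close>
  proof (cases "?u k l = 0")
    case False
    define y where "y = ?u k l"
    have "V' (eigencomponent U M k u) = eigencomponent U M k u"
      using lin_eigencomponent_commute[of V' U, OF commuting_lin[OF commuting_V'] V'_U] V' by simp
    then have V_y: "V y = sc (e (real l / real M')) y"
      unfolding y_def V'_def M'_def[symmetric]
      by (intro eigencomponent_eigenvector isom_lin isom_V pos(2))
    have "U y = eigencomponent V M' l (U (eigencomponent U M k u))"
      unfolding y_def using lin_eigencomponent_commute[of U V, OF isom_lin[OF isom_U] U_V] .
    also have "U (eigencomponent U M k u) = sc (e (real k / real M)) (eigencomponent U M k u)"
      by (intro eigencomponent_eigenvector isom_lin isom_U pos UM)
    finally have U_y: "U y = sc (e (real k / real M)) y"
      unfolding y_def by (simp add: eigencomponent_scale[OF isom_lin[OF isom_V]])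
    have lin_W: "lin (W m)" by (rule commuting_lin[OF commuting_W])
    have "W m y = y"
      unfolding y_def lin_eigencomponent_commute[of "W m" V, OF lin_W W_V]
        lin_eigencomponent_commute[of "W m" U, OF lin_W W_U] W ..
    moreover have "real s * (real l / real M') = real l / (real b - 1)"
      using s_pos b by (simp add: M'_def of_nat_diff)
    ultimately have "y \<in> E" using False U_y V_y by (intro eigenvector_in_E) (auto simp: y_def)
    then show ?thesis unfolding y_def by (rule vs.span_base)
  qed (simp add: vs.span_zero)
  then have "(\<Sum>k<M. \<Sum>l<M'. ?u k l) \<in> vs.span E" by (intro vs.span_sum) auto
  then show ?thesis by (simp add: sum_eigencomponent pos)
qed

text \<open>In \<open>s * (b ^ j * \<alpha> + \<beta>)\<close> the terms with \<open>a\<close>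
  combine to \<open>a * (b ^ j - 1) / (b - 1)\<close>, and \<open>b ^ j\<close> clears the
  denominator \<open>b ^ t\<close> once \<open>j \<ge> t\<close>; the result is an integer.\<close>

lemma W_fixed_E:
  assumes "y \<in> E"
  obtains t where "\<And>j. t \<le> j \<Longrightarrow> W j y = y"
proof -
  obtain \<alpha> \<beta> and a r m m' :: int and t :: nat where y: "U y = sc (e \<alpha>) y" "V y = sc (e \<beta>) y"
      and \<alpha>: "real s * \<alpha> = a / (real b - 1) + r / real b ^ t + m"
      and \<beta>: "real s * \<beta> = - (a / (real b - 1)) + m'"
    using assms unfolding E_def by blast
  have "W j y = y" if "t \<le> j" for j
  proof -
    obtain k :: int where k: "real b ^ j - 1 = (real b - 1) * k" using power_minus_1_div by blast
    have b1: "real b - 1 \<noteq> 0" "real b \<noteq> 0" using b by auto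
    have bj: "real b ^ j / real b ^ t = real b ^ (j - t)" using that b1 by (simp add: power_diff)
    have "real s * (real b ^ j * \<alpha> + \<beta>) = real b ^ j * (real s * \<alpha>) + real s * \<beta>"
      by (simp add: algebra_simps)
    also have "\<dots> = a * (real b ^ j - 1) / (real b - 1) + r * (real b ^ j / real b ^ t)
        + m * real b ^ j + m'"
      unfolding \<alpha> \<beta> by (simp add: field_simps diff_divide_distrib add_divide_distrib)
    also have "\<dots> = of_int (a * k + r * int b ^ (j - t) + m * int b ^ j + m')"
      unfolding bj k using b1 by simp
    finally have "e (real s * (real b ^ j * \<alpha> + \<beta>)) = 1" unfolding e_eq_1_iff by blast
    then show ?thesis by (simp add: W_eigenvector[OF y])
  qed
  then show thesis using that by blast
qed

text \<open>Every digit is a multiple of \<open>s\<close>, so each digit from position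
  \<open>t\<close> on acts by a power of some \<open>W j\<close> that fixes
  \<open>y\<close>.\<close>

lemma phase_fixed_R:
  assumes W: "\<And>j. t \<le> j \<Longrightarrow> W j y = y"
  shows "c \<in> R l \<Longrightarrow> phase t c y = y"
proof (induction l arbitrary: c)
  case 0
  then show ?case by (simp add: phase_def)
next
  case (Suc l)
  then obtain r d where c: "r \<in> R l" "d \<in> D" "c = r + b ^ l * d" by auto
  obtain k where k: "d = s * k" using s_dvd c(2) by blast
  have "(W (t + l) ^^ k) y = y" using W[of "t + l"] by (induction k) auto
  then have "(Z (t + l) ^^ d) y = y" unfolding W_def k by (simp add: funpow_mult)
  then show ?case using phase_block[OF c(1)] Suc.IH[OF c(1)] c(3) Z_pow_phase[OF c(2)] by simp
qed

lemma phase_fixed_E: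
  assumes "y \<in> E"
  shows "\<exists>t. \<forall>c\<in>C. phase t c y = y"
  using W_fixed_E[OF assms] phase_fixed_R unfolding digit_set_eq by (metis UN_E)

section \<open>Averages along initial segments as block sums\<close>

lemma sum_R_phase: "(\<Sum>r\<in>R m. phase 0 r x) = sc (of_nat (card D ^ m)) (B m x)"
proof (induction m)
  case 0
  show ?case by (simp add: phase_def)
next
  case (Suc m)
  have "(\<Sum>r\<in>R (Suc m). phase 0 r x) = (\<Sum>d\<in>D. \<Sum>r\<in>R m. phase 0 (r + b ^ m * d) x)"
    by (rule sum_R_Suc)
  also have "\<dots> = (\<Sum>d\<in>D. \<Sum>r\<in>R m. (Z m ^^ d) (phase 0 r x))"
    by (intro sum.cong refl) (simp add: phase_block Z_pow_phase)
  also have "\<dots> = (\<Sum>d\<in>D. (Z m ^^ d) (sc (of_nat (card D ^ m)) (B m x)))"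
    by (simp add: lin_sum[OF isom_lin[OF isom_funpow[OF isom_Z]], symmetric] Suc)
  also have "\<dots> = sc (of_nat (card D ^ m)) (\<Sum>d\<in>D. (Z m ^^ d) (B m x))"
    by (simp add: lin_scale[OF isom_lin[OF isom_funpow[OF isom_Z]]] vs.scale_sum_right)
  also have "(\<Sum>d\<in>D. (Z m ^^ d) (B m x)) = sc (of_nat (card D)) (B (Suc m) x)"
    using D(2) by (auto simp: avg_def)
  finally show ?case by (simp add: mult.commute)
qed

text \<open>\<open>S\<close> collects the leading parts of complete blocks, each contributing
  \<open>card D ^ m\<close> times an image of \<open>B m x\<close>. At most \<open>2 * b ^ m\<close>
  summands of norm \<open>nrm x\<close> remain.\<close>

lemma segment_block_sum:
  "\<exists>S\<subseteq>C. card S * card D ^ m \<le> card {k \<in> C. k < K} \<and>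
    card {k \<in> C. k < K} \<le> card S * card D ^ m + 2 * b ^ m \<and>
    nrm ((\<Sum>k | k \<in> C \<and> k < K. phase 0 k x) - sc (of_nat (card D ^ m)) (\<Sum>c\<in>S. phase m c (B m x)))
      \<le> 2 * real (b ^ m) * nrm x"
proof -
  define X where "X = {k \<in> C. k < K}"
  define S where "S = {k \<in> C. k < K div b ^ m}"
  define Y where "Y = (\<lambda>(c, r). r + b ^ m * c) ` (S \<times> R m)"
  have YX: "Y \<subseteq> X" and card_XY: "card (X - Y) \<le> 2 * b ^ m"
    unfolding X_def Y_def S_def by (rule initial_segment_blocks)+
  have fin: "finite X" "finite S" "finite Y"
    by (auto simp: X_def S_def Y_def finite_R)
  have card_Y: "card Y = card S * card D ^ m"
    unfolding Y_def by (simp add: card_image[OF block_inj] card_cartesian_product card_R)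
  have "card X = card Y + card (X - Y)"
    using YX fin by (simp add: card_Diff_subset card_mono)
  then have cards: "card S * card D ^ m \<le> card X" "card X \<le> card S * card D ^ m + 2 * b ^ m"
    using card_XY card_Y by auto
  have "(\<Sum>k\<in>Y. phase 0 k x) = (\<Sum>(c, r)\<in>S \<times> R m. phase 0 (r + b ^ m * c) x)"
    unfolding Y_def by (simp only: sum.reindex[OF block_inj]) (simp add: case_prod_unfold)
  also have "\<dots> = (\<Sum>c\<in>S. \<Sum>r\<in>R m. phase 0 (r + b ^ m * c) x)" by (rule sum.cartesian_product[symmetric])
  also have "\<dots> = (\<Sum>c\<in>S. phase m c (\<Sum>r\<in>R m. phase 0 r x))"
    by (intro sum.cong refl) (simp add: phase_block lin_sum[OF isom_lin[OF isom_phase]])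
  also have "\<dots> = sc (of_nat (card D ^ m)) (\<Sum>c\<in>S. phase m c (B m x))"
    by (simp add: sum_R_phase lin_scale[OF isom_lin[OF isom_phase]] vs.scale_sum_right)
  finally have Y: "(\<Sum>k\<in>Y. phase 0 k x) = sc (of_nat (card D ^ m)) (\<Sum>c\<in>S. phase m c (B m x))" .
  have "nrm ((\<Sum>k\<in>X. phase 0 k x) - (\<Sum>k\<in>Y. phase 0 k x)) = nrm (\<Sum>k\<in>X - Y. phase 0 k x)"
    using YX fin by (simp add: sum_diff)
  also have "\<dots> \<le> real (card (X - Y)) * nrm x"
    by (rule nrm_sum_bound) (simp add: isom_nrm[OF isom_phase])
  also have "\<dots> \<le> real (2 * b ^ m) * nrm x"
    using card_XY by (intro mult_right_mono) (auto simp del: of_nat_mult of_nat_power)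
  finally have "nrm ((\<Sum>k\<in>X. phase 0 k x) - (\<Sum>k\<in>Y. phase 0 k x)) \<le> 2 * real (b ^ m) * nrm x" by simp
  moreover have "S \<subseteq> C" by (auto simp: S_def)
  ultimately show ?thesis using cards unfolding Y X_def by blast
qed

lemma A_eq: "A x N = sc (1 / of_nat N) (\<Sum>k | k \<in> C \<and> k < enumerate C N. phase 0 k x)"
proof -
  have "(\<Sum>n=1..N. phase 0 (enumerate C (n - 1)) x) = (\<Sum>k | k \<in> C \<and> k < enumerate C N. phase 0 k x)"
    by (rule sum.reindex_bij_betw[OF enumerate_initial_segment])
  then show ?thesis by (simp add: A_def phase_def del: digsum.simps)
qed

lemma card_segment: "card {k \<in> C. k < enumerate C N} = N"
  using bij_betw_same_card[OF enumerate_initial_segment[of N]] by simp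

lemma lin_A: "lin (\<lambda>x. A x N)"
  unfolding lin_def A_eq
  by (simp add: lin_add[OF isom_lin[OF isom_phase]] lin_scale[OF isom_lin[OF isom_phase]]
      sum.distrib vs.scale_right_distrib vs.scale_sum_right mult.commute)

lemma nrm_A_le: "nrm (A x N) \<le> nrm x"
proof (cases "N = 0")
  case False
  have "nrm (\<Sum>k | k \<in> C \<and> k < enumerate C N. phase 0 k x) \<le> real N * nrm x"
    using nrm_sum_bound[of "{k \<in> C. k < enumerate C N}" "\<lambda>k. phase 0 k x" "nrm x"]
    by (simp add: isom_nrm[OF isom_phase] card_segment)
  then show ?thesis using False by (simp add: A_eq nrm_scale norm_divide field_simps)
qed (simp add: A_eq)

lemma nrm_A_block_le: "nrm (A x N) \<le> nrm (B m x) + 2 * real (b ^ m) * nrm x / real N"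
proof (cases "N = 0")
  case False
  define G where "G = (\<Sum>k | k \<in> C \<and> k < enumerate C N. phase 0 k x)"
  obtain S where S: "card S * card D ^ m \<le> N"
      "nrm (G - sc (of_nat (card D ^ m)) (\<Sum>c\<in>S. phase m c (B m x))) \<le> 2 * real (b ^ m) * nrm x"
    using segment_block_sum[of m "enumerate C N" x] unfolding card_segment G_def by blast
  have "nrm (sc (of_nat (card D ^ m)) (\<Sum>c\<in>S. phase m c (B m x))) \<le> real (card D ^ m) * (real (card S) * nrm (B m x))"
    unfolding nrm_scale norm_of_nat
    by (intro mult_left_mono nrm_sum_bound) (auto simp: isom_nrm[OF isom_phase])
  also have "\<dots> = real (card S * card D ^ m) * nrm (B m x)" by simp
  also have "\<dots> \<le> real N * nrm (B m x)"
    using S(1) by (intro mult_right_mono) (auto simp del: of_nat_mult of_nat_power)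
  finally have "nrm G \<le> real N * nrm (B m x) + 2 * real (b ^ m) * nrm x"
    using S(2) nrm_triangle[of "G - sc (of_nat (card D ^ m)) (\<Sum>c\<in>S. phase m c (B m x))"
        "sc (of_nat (card D ^ m)) (\<Sum>c\<in>S. phase m c (B m x))"] by simp
  then show ?thesis
    using False by (simp add: A_eq G_def[symmetric] nrm_scale norm_divide field_simps)
qed (simp add: A_eq)

lemma A_tendsto_0:
  assumes "(\<lambda>n. nrm (B n x)) \<longlonglongrightarrow> 0"
  shows "hconv ip (A x) 0"
  unfolding hconv_iff
proof (intro allI impI)
  fix r :: real assume r: "r > 0"
  then obtain m where m: "nrm (B m x) < r / 2" using LIMSEQ_D[OF assms, of "r / 2"] by auto
  have "(\<lambda>N. (2 * real (b ^ m) * nrm x) / real N) \<longlonglongrightarrow> 0" by (rule lim_const_over_n)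
  from LIMSEQ_D[OF this, of "r / 2"] obtain M where
    M: "\<And>N. N \<ge> M \<Longrightarrow> \<bar>2 * real (b ^ m) * nrm x / real N\<bar> < r / 2" using r by auto
  have "nrm (A x N - 0) < r" if "N \<ge> M" for N
    using nrm_A_block_le[of x N m] m M[OF that] by simp
  then show "\<exists>M. \<forall>N\<ge>M. nrm (A x N - 0) < r" by blast
qed

text \<open>All block images equal \<open>B m x\<close>. The boundary terms cost
  \<open>2 * b ^ m * nrm x\<close>, and replacing the number of covered terms by \<open>N\<close>
  costs the same again, hence the factor 4.\<close>

lemma A_tendsto_fixed:
  assumes "\<And>c. c \<in> C \<Longrightarrow> phase m c x = x"
  shows "hconv ip (A x) (B m x)"
proof (rule hconvI_le)
  have le: "nrm (A x N - B m x) \<le> 4 * real (b ^ m) * nrm x / real N" if N: "N > 0" for N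
  proof -
    define G where "G = (\<Sum>k | k \<in> C \<and> k < enumerate C N. phase 0 k x)"
    obtain S where S: "S \<subseteq> C" "card S * card D ^ m \<le> N" "N \<le> card S * card D ^ m + 2 * b ^ m"
        "nrm (G - sc (of_nat (card D ^ m)) (\<Sum>c\<in>S. phase m c (B m x))) \<le> 2 * real (b ^ m) * nrm x"
      using segment_block_sum[of m "enumerate C N" x] unfolding card_segment G_def by blast
    have "phase m c (B m x) = B m x" if "c \<in> S" for c
      using commuting_B[OF commuting_phase] assms S(1) that by auto
    then have "sc (of_nat (card D ^ m)) (\<Sum>c\<in>S. phase m c (B m x))
        = sc (of_nat (card D ^ m)) (\<Sum>c\<in>S. sc 1 (B m x))" by simp
    also have "\<dots> = sc (of_nat (card S * card D ^ m)) (B m x)"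
      by (simp add: vs.scale_sum_left[symmetric] mult.commute del: vs.scale_one)
    finally have eq: "sc (of_nat (card D ^ m)) (\<Sum>c\<in>S. phase m c (B m x))
        = sc (of_nat (card S * card D ^ m)) (B m x)" .
    have "nrm (sc (of_nat (card S * card D ^ m)) (B m x) - sc (of_nat N) (B m x))
        = cmod (of_nat (card S * card D ^ m) - of_nat N) * nrm (B m x)"
      by (simp add: vs.scale_left_diff_distrib[symmetric] nrm_scale del: of_nat_mult)
    also have "\<dots> = real (N - card S * card D ^ m) * nrm (B m x)"
      using S(2) by (metis norm_minus_commute norm_of_nat of_nat_diff)
    also have "\<dots> \<le> real (2 * b ^ m) * nrm x"
      using S(3) nrm_B_le by (intro mult_mono) (auto simp del: of_nat_mult of_nat_power)
    finally have "nrm (G - sc (of_nat N) (B m x)) \<le> 4 * real (b ^ m) * nrm x"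
      using S(4) nrm_diff_triangle[of G "sc (of_nat N) (B m x)" "sc (of_nat (card S * card D ^ m)) (B m x)"]
      unfolding eq by simp
    moreover have "A x N - B m x = sc (1 / of_nat N) (G - sc (of_nat N) (B m x))"
      using N by (simp add: A_eq G_def vs.scale_right_diff_distrib)
    ultimately show ?thesis using N by (simp add: nrm_scale norm_divide divide_right_mono)
  qed
  \<comment> \<open>At \<open>N = 0\<close> the average is 0 by convention, so the error is
    \<open>nrm (B m x)\<close>.\<close>
  define f where "f N = (if N = 0 then nrm (B m x) else 4 * real (b ^ m) * nrm x / real N)" for N
  show "nrm (A x N - B m x) \<le> f N" for N
    using le by (cases "N = 0") (auto simp: f_def A_eq)
  have "(\<lambda>N. 4 * real (b ^ m) * nrm x / real N) \<longlonglongrightarrow> 0" by (rule lim_const_over_n)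
  then show "f \<longlonglongrightarrow> 0"
    by (rule Lim_transform_eventually) (auto simp: f_def eventually_sequentially intro!: exI[of _ 1])
qed

section \<open>Convergence for arbitrary vectors\<close>

lemma A_add: "A (x + y) = (\<lambda>N. A x N + A y N)"
  using lin_add[OF lin_A] by fastforce

lemma A_scale: "A (sc a x) = (\<lambda>N. sc a (A x N))"
  using lin_scale[OF lin_A] by fastforce

lemma A_convergent_span:
  assumes "x \<in> vs.span E"
  shows "\<exists>L. hconv ip (A x) L"
  using assms
proof (rule vs.span_induct)
  show "vs.subspace {x. \<exists>L. hconv ip (A x) L}"
  proof (rule vs.subspaceI)
    have "A 0 = (\<lambda>N. 0)" using lin_zero[OF lin_A] by blast
    then show "0 \<in> {x. \<exists>L. hconv ip (A x) L}" by (auto simp: hconv_def intro!: exI[of _ 0])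
  qed (auto simp: A_add A_scale intro: hconv_add hconv_scale)
  fix y assume "y \<in> E"
  then obtain t where "\<forall>c\<in>C. phase t c y = y" using phase_fixed_E by blast
  then show "\<exists>L. hconv ip (A y) L" using A_tendsto_fixed[of t y] by blast
qed

text \<open>The averages are contractions uniformly in \<open>N\<close>, so those of
  \<open>p\<close> inherit the Cauchy property from a nearby vector of the span.\<close>

lemma A_convergent_closed_span:
  assumes "p \<in> closed_span sc ip E"
  shows "\<exists>L. hconv ip (A p) L"
proof (rule complete)
  fix r :: real assume r: "r > 0"
  then obtain w where w: "w \<in> vs.span E" "nrm (p - w) < r / 4"
    using assms[unfolded closed_span_def] by (auto dest!: spec[of _ "r / 4"])
  obtain L where "hconv ip (A w) L" using A_convergent_span[OF w(1)] by blast
  then obtain M where M: "\<And>N. N \<ge> M \<Longrightarrow> nrm (A w N - L) < r / 4"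
    unfolding hconv_iff using r by (metis divide_pos_pos zero_less_numeral)
  have near: "nrm (A p N - L) < r / 2" if "N \<ge> M" for N
  proof -
    have "nrm (A p N - A w N) \<le> nrm (p - w)"
      using nrm_A_le[of "p - w" N] lin_diff[OF lin_A] by simp
    then show ?thesis using nrm_diff_triangle[of "A p N" L "A w N"] M[OF that] w(2) by linarith
  qed
  have "nrm (A p m - A p n) < r" if "m \<ge> M" "n \<ge> M" for m n
    using nrm_diff_triangle[of "A p m" "A p n" L] near[OF that(1)] near[OF that(2)]
    by (simp add: nrm_minus_commute[of L])
  then show "\<exists>M. \<forall>m\<ge>M. \<forall>n\<ge>M. nrm (A p m - A p n) < r" by blast
qed

lemma A_tendsto_0_orthogonal:
  assumes "\<forall>y\<in>E. ip x y = 0"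
  shows "hconv ip (A x) 0"
proof (rule A_tendsto_0[OF B_tendsto_0])
  fix m u assume "V' u = u" "W m u = u"
  then have "u \<in> vs.span E" by (rule fixed_in_span_E)
  then show "ip x u = 0"
  proof (rule vs.span_induct)
    show "vs.subspace {u. ip x u = 0}"
      by (rule vs.subspaceI) (auto simp: ip_add_right ip_scale_right)
  qed (use assms in blast)
qed

text \<open>The averages of \<open>x\<close> are those of \<open>p\<close> plus those of
  \<open>x - p\<close>, and the latter tend to 0 by orthogonality to \<open>E\<close>.\<close>

lemma A_orth_proj:
  assumes "is_orth_proj sc ip E x p"
  shows "\<exists>L. hconv ip (A x) L \<and> hconv ip (A p) L"
proof -
  obtain L where L: "hconv ip (A p) L"
    using assms A_convergent_closed_span unfolding is_orth_proj_def by blast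
  moreover have "hconv ip (A (x - p)) 0"
    using assms A_tendsto_0_orthogonal unfolding is_orth_proj_def by blast
  ultimately have "hconv ip (A x) L"
    using hconv_add[of "A p" L "A (x - p)" 0] by (simp add: A_add[symmetric])
  with L show ?thesis by blast
qed

lemma A_convergent: "\<exists>L. hconv ip (A x) L"
proof -
  obtain p where "\<And>r. r > 0 \<Longrightarrow> \<exists>w\<in>vs.span E. nrm (p - w) < r"
      "\<And>w. w \<in> vs.span E \<Longrightarrow> ip (x - p) w = 0"
    using orthogonal_projection_exists[OF vs.subspace_span] by blast
  then have "is_orth_proj sc ip E x p"
    unfolding is_orth_proj_def closed_span_def using vs.span_base by auto
  then show ?thesis using A_orth_proj by blast
qed

end

lemma (in hilbert) unitary_op_isom:
  assumes "unitary_op sc ip f"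
  shows "isom f"
proof -
  have "module_hom sc sc f" using assms by (simp add: unitary_op_def linear_iff_module_hom)
  then show ?thesis
    using assms by (simp add: isom_def lin_def unitary_op_def module_hom.add module_hom.scale)
qed

theorem mainTheorem12:
  fixes b s :: nat and D :: "nat set"
    and sc :: "complex \<Rightarrow> 'h::ab_group_add \<Rightarrow> 'h" and ip :: "'h \<Rightarrow> 'h \<Rightarrow> complex"
    and U V :: "'h \<Rightarrow> 'h"
  assumes b: "b \<ge> 3"
    and D: "D \<subseteq> {0..<b}" "2 \<le> card D" "card D < b"
    and s: "int s = Gcd {int d - int d' | d d'. d \<in> D \<and> d' \<in> D}"
    and sdvd: "\<forall>d\<in>D. s dvd d"
    and H: "complex_hilbert sc ip"
    and UV: "unitary_op sc ip U" "unitary_op sc ip V" "U \<circ> V = V \<circ> U"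
  defines "A \<equiv> (\<lambda>x N. sc (1 / of_nat N) (\<Sum>n=1..N. (U ^^ enumerate (digit_set b D) (n - 1))
                ((V ^^ digsum b (enumerate (digit_set b D) (n - 1))) x)))"
    and "E \<equiv> {y. y \<noteq> 0 \<and> (\<exists>\<alpha> \<beta> :: real. U y = sc (e \<alpha>) y \<and> V y = sc (e \<beta>) y \<and>
               (\<exists>(a::int) (r::int) (t::nat).
                  (\<exists>m::int. real s * \<alpha> = a / (real b - 1) + r / real b ^ t + m) \<and>
                  (\<exists>m::int. real s * \<beta> = - (a / (real b - 1)) + m)))}"
  shows "(\<forall>x. \<exists>L. hconv ip (A x) L)
       \<and> (\<forall>x p. is_orth_proj sc ip E x p \<longrightarrow> (\<exists>L. hconv ip (A x) L \<and> hconv ip (A p) L))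
       \<and> (\<forall>x. (\<forall>y\<in>E. ip x y = 0) \<longrightarrow> hconv ip (A x) 0)"
proof -
  interpret hilbert sc ip using H by unfold_locales
  interpret ops: digit_operators sc ip b s D U V
    using b D(1,2) s sdvd unitary_op_isom[OF UV(1)] unitary_op_isom[OF UV(2)] fun_cong[OF UV(3)]
    by unfold_locales auto
  show ?thesis
    unfolding A_def E_def ops.A_def[symmetric] ops.E_def[symmetric]
    using ops.A_convergent ops.A_orth_proj ops.A_tendsto_0_orthogonal by blast
qed

end
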